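(* Let $q$ be an odd positive integer with $q<2^{32}$, and let $m$ be a positive integer with $m\leq q$ and $m \mid q\cdot 2^{q-1}$. Then $P_m$ divides $Q_q$.
   Context: $Q_q$ denotes the $q$-dimensional hypercube graph: vertices are the $q$-tuples of $0$'s and $1$'s, two vertices adjacent iff they differ in exactly one coordinate. $P_m$ denotes the path with $m$ edges (vertices $0,1,\dots,m$, edges joining $j-1$ and $j$). For graphs $H$ and $G$, "$H$ divides $G$" means there is a collection of subgraphs $H_i$ of $G$, each isomorphic to $H$, such that $E(G)$ is the disjoint union of the edge sets $E(H_i)$. *)

theory Defs
  imports Main
begin

type_synonym 'a graph = "'a set \<times> 'a set set"

definition verts :: "'a graph \<Rightarrow> 'a set" where "verts G = fst G"
definition edges :: "'a graph \<Rightarrow> 'a set set" where "edges G = snd G"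

definition wf_graph :: "'a graph \<Rightarrow> bool" where
  "wf_graph G \<longleftrightarrow> (\<forall>e\<in>edges G. \<exists>u v. u \<noteq> v \<and> u \<in> verts G \<and> v \<in> verts G \<and> e = {u, v})"

definition subgraph :: "'a graph \<Rightarrow> 'a graph \<Rightarrow> bool" where
  "subgraph H G \<longleftrightarrow> wf_graph H \<and> verts H \<subseteq> verts G \<and> edges H \<subseteq> edges G"

definition graph_iso :: "'a graph \<Rightarrow> 'b graph \<Rightarrow> bool" where
  "graph_iso G H \<longleftrightarrow> (\<exists>f. bij_betw f (verts G) (verts H) \<and>
     (\<forall>u\<in>verts G. \<forall>v\<in>verts G. {u, v} \<in> edges G \<longleftrightarrow> {f u, f v} \<in> edges H))"

definition graph_divides :: "'b graph \<Rightarrow> 'a graph \<Rightarrow> bool" where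
  "graph_divides H G \<longleftrightarrow> (\<exists>S. (\<forall>K\<in>S. subgraph K G \<and> graph_iso K H) \<and>
     (\<Union>K\<in>S. edges K) = edges G \<and>
     (\<forall>K1\<in>S. \<forall>K2\<in>S. K1 \<noteq> K2 \<longrightarrow> edges K1 \<inter> edges K2 = {}))"

definition hypercube :: "nat \<Rightarrow> bool list graph" where
  "hypercube q = ({x. length x = q},
     {{x, y} | x y. length x = q \<and> length y = q \<and> card {i. i < q \<and> x ! i \<noteq> y ! i} = 1})"

definition path_graph :: "nat \<Rightarrow> nat graph" where
  "path_graph m = ({0..m}, {{j - 1, j} | j. 1 \<le> j \<and> j \<le> m})"

end

(*
  Write m = 2^a d with d odd; then q = d e with e odd and 2^a <= e. A decomposition of the e-cube
  into paths of length k gives one of the (d e)-cube into paths of length k d, by replacing each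
  coordinate by a block of d coordinates that are flipped in succession. This leaves paths of
  length M = 2^a in the e-cube. For M = 1 they are the edges. Otherwise e > M, and 2r > a of the
  coordinates are seen as a product of r directed 4-cycles, whose arcs split into r permutations,
  the first being a Hamiltonian cycle of length 4^r. Half of the vertices are starting points of
  walks of length M that use the same sequence of moves; what they leave uncovered are closed
  trails of length 4^r (e - M), which are cut into pieces of length M, as M divides 4^r.
*)
theory Submission
  imports Defs "HOL-Number_Theory.Cong"
begin

section \<open>Path decompositions of the cube\<close>

text \<open>Orienting the 4-cycles makes each move a permutation of the vertices, so at any given
  time the walks pass through all vertices of one side. An edge in a toggled direction has one end
  on each side, hence one move per walk covers the whole direction. The arcs of a rotor keep to one
  side, hence a rotor must be applied twice, after an even and after an odd number of toggles. Rotor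
  0 is the exception: its second half goes to the closed trails, which otherwise would consist of
  toggles only and close up after \<open>2 * (e - M)\<close> moves, a length that \<open>M\<close>
  need not divide. A Hamiltonian cycle there makes the length a multiple of \<open>4 ^ r\<close>,
  hence of \<open>M\<close>. That \<open>e - M - 1\<close> is even keeps these rotor moves on the
  odd side. No walk meets itself, since level plus number of toggles counts the time modulo
  4.\<close>

text \<open>A vertex of the cube is the set of coordinates that are 1, a path is a function
  on the natural numbers of which only the values up to the length matter.\<close>

definition flip :: "nat set \<Rightarrow> nat set \<Rightarrow> nat set"
  where "flip A X = {x. (x \<in> A) \<noteq> (x \<in> X)}"

lemma mem_flip [simp]: "x \<in> flip A X \<longleftrightarrow> (x \<in> A) \<noteq> (x \<in> X)"
  by (simp add: flip_def)

abbreviation tog :: "nat \<Rightarrow> nat set \<Rightarrow> nat set"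
  where "tog j \<equiv> flip {j}"

lemma flip_flip [simp]: "flip A (flip A X) = X"
  by auto

lemma flip_empty [simp]: "flip {} X = X"
  by auto

lemma flip_inject [simp]: "flip A X = flip A Y \<longleftrightarrow> X = Y"
  by (metis flip_flip)

lemma flip_commute: "flip A X = flip X A"
  by auto

lemma flip_assoc: "flip (flip A B) X = flip A (flip B X)"
  by auto

lemma flip_inject_left: "flip A X = flip B X \<longleftrightarrow> A = B"
  by (metis flip_commute flip_inject)

lemma flip_subset: "A \<subseteq> U \<Longrightarrow> X \<subseteq> U \<Longrightarrow> flip A X \<subseteq> U"
  by auto

lemma finite_flip [simp]: "finite A \<Longrightarrow> finite X \<Longrightarrow> finite (flip A X)"
  by (rule finite_subset[of _ "A \<union> X"]) auto

lemma flip_Int_Diff: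
  assumes "A \<subseteq> U" "X \<inter> U = {}"
  shows "flip A X \<inter> U = A" and "flip A X - U = X"
  using assms by auto

lemma even_card_flip:
  assumes "finite A" "finite X"
  shows "even (card (flip A X)) \<longleftrightarrow> (even (card A) \<longleftrightarrow> even (card X))"
proof -
  have "card (flip A X) = card (A - X) + card (X - A)"
  proof -
    have "flip A X = (A - X) \<union> (X - A)" by auto
    then show ?thesis using card_Un_disjoint[of "A - X" "X - A"] assms by simp blast
  qed
  moreover have "card A = card (A - X) + card (A \<inter> X)"
    using card_Int_Diff[OF assms(1), of X] by simp
  moreover have "card X = card (X - A) + card (A \<inter> X)"
    using card_Int_Diff[OF assms(2), of A] by (simp add: Int_commute)
  ultimately show ?thesis by auto
qed

section \<open>The edge set of the cube and its size\<close>

definition cube_edges :: "nat \<Rightarrow> nat set set set"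
  where "cube_edges n = {{X, tog j X} | X j. X \<subseteq> {..<n} \<and> j < n}"

lemma edge_sym: "{X, tog j X} = {tog j X, tog j (tog j X)}"
  by (simp add: insert_commute)

lemma edge_cases:
  assumes "X \<subseteq> {..<n}" "j < n"
  obtains W where "W \<subseteq> {..<n}" "{X, tog j X} = {W, tog j W}" "P = (j \<in> W)"
proof (cases "P = (j \<in> X)")
  case True then show ?thesis using that assms by blast
next
  case False
  have "tog j X \<subseteq> {..<n}" using assms by auto
  then show ?thesis using that[OF _ edge_sym] False by simp
qed

text \<open>Normal form of an edge: its direction and the end without that coordinate. It serves to
  count the edges.\<close>

lemma bij_edges:
  "bij_betw (\<lambda>(j, X). {X, tog j X}) (SIGMA j:{..<n}. Pow ({..<n} - {j})) (cube_edges n)"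
proof (rule bij_betw_imageI)
  show "inj_on (\<lambda>(j, X). {X, tog j X}) (SIGMA j:{..<n}. Pow ({..<n} - {j}))"
  proof (rule inj_onI, clarify)
    fix j X k Y
    assume "X \<subseteq> {..<n} - {j}" "Y \<subseteq> {..<n} - {k}"
      and eq: "{X, tog j X} = {Y, tog k Y}"
    then have *: "j \<notin> X" "k \<notin> Y" by auto
    show "j = k \<and> X = Y"
    proof (cases "X = Y")
      case True
      then have "tog j X = tog k X" using eq by (metis doubleton_eq_iff)
      then have "j = k" by (auto simp: set_eq_iff)
      then show ?thesis using True by simp
    next
      case False
      then have "X = tog k Y" "Y = tog j X" using eq by (auto simp: doubleton_eq_iff)
      then show ?thesis using * by (auto simp: set_eq_iff) 
    qed
  qed
  show "(\<lambda>(j, X). {X, tog j X}) ` (SIGMA j:{..<n}. Pow ({..<n} - {j})) = cube_edges n"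
  proof
    show "(\<lambda>(j, X). {X, tog j X}) ` (SIGMA j:{..<n}. Pow ({..<n} - {j})) \<subseteq> cube_edges n"
      unfolding cube_edges_def by fastforce
    show "cube_edges n \<subseteq> (\<lambda>(j, X). {X, tog j X}) ` (SIGMA j:{..<n}. Pow ({..<n} - {j}))"
    proof
      fix E assume "E \<in> cube_edges n"
      then obtain X j where "E = {X, tog j X}" "X \<subseteq> {..<n}" "j < n"
        unfolding cube_edges_def by blast
      then obtain W where "W \<subseteq> {..<n}" "E = {W, tog j W}" "False = (j \<in> W)"
        using edge_cases by metis
      then show "E \<in> (\<lambda>(j, X). {X, tog j X}) ` (SIGMA j:{..<n}. Pow ({..<n} - {j}))"
        using \<open>j < n\<close> by (intro image_eqI[of _ _ "(j, W)"]) auto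
    qed
  qed
qed

lemma card_cube_edges: "card (cube_edges n) = n * 2 ^ (n - 1)"
proof -
  have "card (SIGMA j:{..<n}. Pow ({..<n} - {j})) = n * 2 ^ (n - 1)"
    by (simp add: card_SigmaI card_Pow card_Diff_singleton)
  then show ?thesis
    using bij_betw_same_card[OF bij_edges[of n]] by simp
qed

definition path_dec :: "nat \<Rightarrow> nat \<Rightarrow> bool" where
  "path_dec m n \<longleftrightarrow> (\<exists>S. finite S \<and> (\<forall>p\<in>S. inj_on p {..m}) \<and>
     bij_betw (\<lambda>(p, j). {p j, p (Suc j)}) (S \<times> {..<m}) (cube_edges n))"

text \<open>Covering all edges with few enough paths forces the edges of the paths to be cube edges,
  each used once.\<close>

lemma path_decI:
  assumes fin: "finite S" and inj: "\<And>p. p \<in> S \<Longrightarrow> inj_on p {..m}"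
    and cover: "\<And>X j. X \<subseteq> {..<n} \<Longrightarrow> j < n \<Longrightarrow> \<exists>p\<in>S. \<exists>i<m. {p i, p (Suc i)} = {X, tog j X}"
    and card: "card S * m \<le> n * 2 ^ (n - 1)"
  shows "path_dec m n"
proof -
  let ?f = "\<lambda>(p, j). {p j, p (Suc j)} :: nat set set" and ?A = "S \<times> {..<m}"
  have finA: "finite ?A" using fin by simp
  have sub: "cube_edges n \<subseteq> ?f ` ?A"
  proof
    fix E assume "E \<in> cube_edges n"
    then obtain X j where E: "E = {X, tog j X}" "X \<subseteq> {..<n}" "j < n"
      unfolding cube_edges_def by blast
    obtain p i where "p \<in> S" "i < m" "{p i, p (Suc i)} = E"
      using cover[OF E(2,3)] E(1) by auto
    then show "E \<in> ?f ` ?A" by (intro image_eqI[of _ _ "(p, i)"]) auto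
  qed
  have le: "card ?A \<le> card (cube_edges n)"
    using card by (simp add: card_cube_edges card_cartesian_product)
  have "card (?f ` ?A) \<le> card (cube_edges n)"
    using card_image_le[OF finA] le by (rule order_trans)
  then have im: "cube_edges n = ?f ` ?A"
    using sub finA by (intro card_seteq) auto
  then have "card (?f ` ?A) = card ?A"
    using le card_image_le[OF finA, of ?f] by simp
  then have "inj_on ?f ?A" using finA by (rule eq_card_imp_inj_on[rotated])
  then show ?thesis
    unfolding path_dec_def bij_betw_def using im fin inj by blast
qed

section \<open>A rotor system on a product of directed 4-cycles\<close>

text \<open>Coordinates \<open>2 i\<close> and \<open>2 i + 1\<close> span a 4-cycle, oriented 00, 10, 11, 01; \<open>digit\<close> numbers its
  vertices along the orientation and \<open>step\<close> moves along it.\<close>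

definition digit :: "nat \<Rightarrow> nat set \<Rightarrow> nat" where
  "digit i X = (if 2 * i \<in> X then if Suc (2 * i) \<in> X then 2 else 1
     else if Suc (2 * i) \<in> X then 3 else 0)"

definition quad :: "nat \<Rightarrow> nat \<Rightarrow> nat set" where
  "quad i n = (if n mod 4 \<in> {1, 2} then {2 * i} else {}) \<union>
     (if n mod 4 \<in> {2, 3} then {Suc (2 * i)} else {})"

definition coord :: "nat \<Rightarrow> nat set \<Rightarrow> nat" where
  "coord i X = (if (2 * i \<in> X) = (Suc (2 * i) \<in> X) then 2 * i else Suc (2 * i))"

definition step :: "nat \<Rightarrow> nat set \<Rightarrow> nat set" where
  "step i X = tog (coord i X) X"

definition level :: "nat \<Rightarrow> nat set \<Rightarrow> nat" where
  "level r X = (\<Sum>i<r. digit i X)"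

text \<open>\<open>rotor r k\<close>, for \<open>k < r\<close>, are permutations whose arcs partition the arcs of the product of
  \<open>r\<close> directed 4-cycles, and \<open>rotor r 0\<close> is a single cycle, parametrised by \<open>orbit r\<close>. When a
  4-cycle is added, the old permutation 0 and the step in the new factor are interchanged on the
  vertices of level 3 modulo 4: the new permutation 0 then makes three old moves followed by one
  step in the new factor. Every move raises the level by 1, so permutations remain
  permutations.\<close>

primrec gear :: "nat \<Rightarrow> nat \<Rightarrow> nat set \<Rightarrow> nat" where
  "gear 0 k X = 0"
| "gear (Suc r) k X =
     (if k = 0 then if level (Suc r) X mod 4 = 3 then r else gear r 0 X
      else if k = r then if level (Suc r) X mod 4 = 3 then gear r 0 X else r
      else gear r k X)"

definition rotor :: "nat \<Rightarrow> nat \<Rightarrow> nat set \<Rightarrow> nat set" where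
  "rotor r k X = step (gear r k X) X"

primrec orbit :: "nat \<Rightarrow> nat \<Rightarrow> nat set" where
  "orbit 0 t = {}"
| "orbit (Suc r) t = (if r = 0 then quad 0 t else orbit r (t - t div 4) \<union> quad r (t div 4))"

lemma digit_step: "digit i (step i X) mod 4 = Suc (digit i X) mod 4"
  by (cases "2 * i \<in> X"; cases "Suc (2 * i) \<in> X"; simp add: digit_def step_def coord_def)

lemma digit_step_other: "i \<noteq> j \<Longrightarrow> digit i (step j X) = digit i X"
proof -
  assume "i \<noteq> j"
  then have "2 * i \<noteq> 2 * j" "Suc (2 * i) \<noteq> 2 * j" "2 * i \<noteq> Suc (2 * j)" by presburger+
  then show ?thesis by (auto simp: digit_def step_def coord_def)
qed

lemma level_step: "i < r \<Longrightarrow> level r (step i X) mod 4 = Suc (level r X) mod 4"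
proof -
  assume i: "i < r"
  have "level r (step i X) = digit i (step i X) + (\<Sum>j\<in>{..<r} - {i}. digit j X)"
    using i unfolding level_def
    by (subst sum.remove[of _ i]) (auto intro!: sum.cong simp: digit_step_other)
  moreover have "level r X = digit i X + (\<Sum>j\<in>{..<r} - {i}. digit j X)"
    using i unfolding level_def by (subst sum.remove[of _ i]) auto
  ultimately show ?thesis
    using digit_step[of i X] by (metis add_Suc mod_add_left_eq)
qed

text \<open>The coordinate just flipped can be read off after the step.\<close>

lemma coord_step:
  "coord i X = (if (2 * i \<in> step i X) \<noteq> (Suc (2 * i) \<in> step i X) then 2 * i else Suc (2 * i))"
  by (cases "2 * i \<in> X"; cases "Suc (2 * i) \<in> X"; simp add: step_def coord_def)

lemma step_inject: "step i X = step i Y \<longleftrightarrow> X = Y"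
  using coord_step[of i X] coord_step[of i Y] by (auto simp only: step_def flip_inject)

lemma gear_less: "k < r \<Longrightarrow> gear r k X < r"
proof (induction r arbitrary: k)
  case (Suc r)
  show ?case
  proof (cases "r = 0")
    case False
    then have "gear r 0 X < r" by (intro Suc.IH) simp
    moreover have "k < r \<or> k = r" using Suc.prems by auto
    ultimately show ?thesis using Suc.IH[of k] by auto
  qed simp
qed simp

text \<open>Each stage of the recursion only exchanges two values, so the gears at a fixed vertex
  permute the factors. Surjectivity is the half that covering needs.\<close>

lemma gear_surj: "i < r \<Longrightarrow> \<exists>k<r. gear r k X = i"
proof (induction r)
  case (Suc r)
  show ?case
  proof (cases "i = r")
    case True
    show ?thesis
    proof (cases "level (Suc r) X mod 4 = 3")
      case True then show ?thesis using \<open>i = r\<close> by (intro exI[of _ 0]) simp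
    next
      case False then show ?thesis using \<open>i = r\<close> by (cases "r = 0") (auto intro!: exI[of _ r])
    qed
  next
    case False
    then obtain k where k: "k < r" "gear r k X = i" using Suc by auto
    show ?thesis
    proof (cases "k = 0 \<and> level (Suc r) X mod 4 = 3")
      case True then show ?thesis using k by (intro exI[of _ r]) auto
    next
      case False then show ?thesis using k by (intro exI[of _ k]) auto
    qed
  qed
qed simp

lemma level_rotor: "k < r \<Longrightarrow> level r (rotor r k X) mod 4 = Suc (level r X) mod 4"
  unfolding rotor_def by (intro level_step gear_less)

lemma Suc_mod_4_inject: "Suc a mod 4 = Suc b mod 4 \<longleftrightarrow> a mod 4 = b mod 4"
  using mod_Suc[of a 4] mod_Suc[of b 4] by (auto split: if_splits)

text \<open>Equal images have equal levels modulo 4, hence so do \<open>X\<close> and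
  \<open>Y\<close>, and the exchange of moves happens at both or at neither. Then one injective map
  was applied to both.\<close>

lemma rotor_inject: "k < r \<Longrightarrow> rotor r k X = rotor r k Y \<Longrightarrow> X = Y"
proof (induction r arbitrary: k)
  case (Suc r)
  let ?top = "\<lambda>Z. level (Suc r) Z mod 4 = 3"
  have "level (Suc r) X mod 4 = level (Suc r) Y mod 4"
    using level_rotor[OF Suc.prems(1), of X] level_rotor[OF Suc.prems(1), of Y] Suc.prems(2)
    by (metis Suc_mod_4_inject)
  then have top: "?top X = ?top Y" by simp
  have low: "rotor r 0 X = rotor r 0 Y \<Longrightarrow> X = Y"
    using Suc.IH[of 0] by (cases "r = 0") (simp_all add: rotor_def step_inject)
  have rot: "rotor (Suc r) k Z = (if k = 0 then if ?top Z then step r Z else rotor r 0 Z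
      else if k = r then if ?top Z then rotor r 0 Z else step r Z else rotor r k Z)" for Z
    by (simp add: rotor_def)
  consider "k = 0" | "k = r" "k \<noteq> 0" | "k < r" "k \<noteq> 0" using Suc.prems(1) by linarith
  then show ?case
  proof cases
    case 1 then show ?thesis
      using Suc.prems(2) top low unfolding rot by (cases "?top X") (simp_all add: step_inject)
  next
    case 2 then show ?thesis
      using Suc.prems(2) top low unfolding rot by (cases "?top X") (simp_all add: step_inject)
  next
    case 3 then show ?thesis
      using Suc.prems(2) Suc.IH[of k] unfolding rot by simp
  qed
qed simp

lemma level_cong: "X \<inter> {..<2 * r} = Y \<inter> {..<2 * r} \<Longrightarrow> level r X = level r Y"
proof -
  assume eq: "X \<inter> {..<2 * r} = Y \<inter> {..<2 * r}"
  have *: "x \<in> X \<longleftrightarrow> x \<in> Y" if "x < 2 * r" for x using eq that by blast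
  have "digit i X = digit i Y" if "i < r" for i
    using *[of "2 * i"] *[of "Suc (2 * i)"] that by (simp add: digit_def)
  then show ?thesis unfolding level_def by (intro sum.cong) simp_all
qed

lemma gear_cong: "X \<inter> {..<2 * r} = Y \<inter> {..<2 * r} \<Longrightarrow> gear r k X = gear r k Y"
proof (induction r arbitrary: k)
  case (Suc r)
  have "X \<inter> {..<2 * r} = Y \<inter> {..<2 * r}"
  proof -
    have "Z \<inter> {..<2 * r} = Z \<inter> {..<2 * Suc r} \<inter> {..<2 * r}" for Z :: "nat set" by auto
    then show ?thesis using Suc.prems by metis
  qed
  then have "gear r k X = gear r k Y" for k by (rule Suc.IH)
  moreover have "level (Suc r) X = level (Suc r) Y" by (rule level_cong[OF Suc.prems])
  ultimately show ?case by simp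
qed simp

lemma step_flip:
  assumes "i < r" "A \<inter> {..<2 * r} = {}"
  shows "step i (flip A X) = flip A (step i X)"
proof -
  have "2 * i \<notin> A" "Suc (2 * i) \<notin> A" using assms by auto
  then show ?thesis by (auto simp: step_def coord_def)
qed

text \<open>The gears read only coordinates below \<open>2 * r\<close>, so translating the others
  carries what is known about \<open>orbit\<close> to the whole cube.\<close>

lemma rotor_flip:
  assumes "k < r" "A \<inter> {..<2 * r} = {}"
  shows "rotor r k (flip A X) = flip A (rotor r k X)"
proof -
  have "flip A X \<inter> {..<2 * r} = X \<inter> {..<2 * r}" using assms by auto
  then show ?thesis
    unfolding rotor_def using gear_cong step_flip assms gear_less by metis
qed

lemma rotor_subset: "k < r \<Longrightarrow> X \<subseteq> U \<Longrightarrow> {..<2 * r} \<subseteq> U \<Longrightarrow> rotor r k X \<subseteq> U"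
proof -
  assume a: "k < r" "X \<subseteq> U" "{..<2 * r} \<subseteq> U"
  have "gear r k X < r" using a(1) by (rule gear_less)
  then have "coord (gear r k X) X < 2 * r" by (auto simp: coord_def)
  then show ?thesis unfolding rotor_def step_def using a by auto
qed

lemma rotor_diff: "k < r \<Longrightarrow> rotor r k X - {..<2 * r} = X - {..<2 * r}"
proof -
  assume a: "k < r"
  have "gear r k X < r" using a(1) by (rule gear_less)
  then have "coord (gear r k X) X < 2 * r" by (auto simp: coord_def)
  then show ?thesis unfolding rotor_def step_def by auto
qed

text \<open>One of the two orientations of the edge follows the directed 4-cycle; \<open>W\<close>
  is its tail, and some rotor uses that arc.\<close>

lemma edge_rotor:
  assumes "j < 2 * r"
  obtains k W where "k < r" "{X, tog j X} = {W, rotor r k W}" "W = X \<or> W = tog j X"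
proof -
  define i where "i = j div 2"
  have j: "j = 2 * i \<or> j = Suc (2 * i)" unfolding i_def by linarith
  have "coord i X = j \<or> coord i (tog j X) = j"
    using j by (elim disjE; cases "2 * i \<in> X"; cases "Suc (2 * i) \<in> X"; simp add: coord_def)
  then have "\<exists>W. (W = X \<or> W = tog j X) \<and> coord (j div 2) W = j"
    unfolding i_def by blast
  then obtain W where W: "W = X \<or> W = tog j X" "coord (j div 2) W = j" by blast
  have "j div 2 < r" using assms by simp
  then obtain k where k: "k < r" "gear r k W = j div 2" using gear_surj by blast
  then have "rotor r k W = tog j W" using W by (simp add: rotor_def step_def)
  then show ?thesis using that[OF k(1), of W] W(1) edge_sym by metis
qed

section \<open>The Hamiltonian cycle of rotor 0\<close>

lemma orbit_subset: "orbit r t \<subseteq> {..<2 * r}"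
proof (induction r arbitrary: t)
  case (Suc r)
  have "orbit r s \<subseteq> {..<2 * Suc r}" for s
    using Suc.IH[of s] by fastforce
  then show ?case by (auto simp: quad_def)
qed simp

lemma digit_quad: "A \<subseteq> {..<2 * r} \<Longrightarrow> digit r (A \<union> quad r n) = n mod 4"
proof -
  assume "A \<subseteq> {..<2 * r}"
  then have "2 * r \<notin> A" "Suc (2 * r) \<notin> A" by auto
  moreover have "n mod 4 = 0 \<or> n mod 4 = 1 \<or> n mod 4 = 2 \<or> n mod 4 = 3" by linarith
  ultimately show ?thesis by (elim disjE) (simp_all add: digit_def quad_def)
qed

lemma quad_disjoint: "quad r n \<inter> {..<2 * r} = {}"
  by (auto simp: quad_def)

lemma level_Suc_quad:
  assumes "A \<subseteq> {..<2 * r}"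
  shows "level (Suc r) (A \<union> quad r n) = level r A + n mod 4"
proof -
  have "(A \<union> quad r n) \<inter> {..<2 * r} = A \<inter> {..<2 * r}"
    by (simp add: Int_Un_distrib2 quad_disjoint)
  then have "level r (A \<union> quad r n) = level r A" by (rule level_cong)
  then show ?thesis using digit_quad[OF assms] by (simp add: level_def)
qed

text \<open>Among the first \<open>t\<close> moves of the new rotor 0, \<open>t div 4\<close> are
  steps in the new factor and \<open>t - t div 4\<close> are old moves; each raises the level by
  1.\<close>

lemma level_orbit: "0 < r \<Longrightarrow> level r (orbit r t) mod 4 = t mod 4"
proof (induction r arbitrary: t)
  case (Suc r)
  show ?case
  proof (cases "r = 0")
    case True
    then show ?thesis using digit_quad[of "{}" 0 t] by (simp add: level_def)
  next
    case False
    then have "level r (orbit r (t - t div 4)) mod 4 = (t - t div 4) mod 4"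
      using Suc.IH by simp
    moreover have "level (Suc r) (orbit (Suc r) t) = level r (orbit r (t - t div 4)) + t div 4 mod 4"
      using False level_Suc_quad[OF orbit_subset] by simp
    moreover have "t div 4 \<le> t" by simp
    ultimately show ?thesis by (metis le_add_diff_inverse2 mod_add_eq mod_mod_trivial)
  qed
qed simp

text \<open>The level reveals \<open>t mod 4\<close>. The old coordinates reveal the number
  \<open>3 * (t div 4) + t mod 4\<close> of old moves modulo \<open>4 ^ r\<close>, and 3 is
  invertible there. This is why one new step after three old moves produces a single cycle.\<close>

lemma orbit_inj: "0 < r \<Longrightarrow> orbit r s = orbit r t \<Longrightarrow> s mod 4 ^ r = t mod 4 ^ r"
proof (induction r arbitrary: s t)
  case (Suc r)
  have lev: "s mod 4 = t mod 4"
    using level_orbit[of "Suc r" s] level_orbit[of "Suc r" t] Suc.prems(2) by simp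
  show ?case
  proof (cases "r = 0")
    case True then show ?thesis using lev by simp
  next
    case False
    have "orbit (Suc r) s \<inter> {..<2 * r} = orbit (Suc r) t \<inter> {..<2 * r}" using Suc.prems by simp
    moreover have "orbit (Suc r) u \<inter> {..<2 * r} = orbit r (u - u div 4)" for u
      using False orbit_subset[of r "u - u div 4"] quad_disjoint[of r "u div 4"]
      by (simp add: Int_Un_distrib2 inf_absorb1)
    ultimately have "orbit r (s - s div 4) = orbit r (t - t div 4)" by metis
    then have "(s - s div 4) mod 4 ^ r = (t - t div 4) mod 4 ^ r"
      using Suc.IH False by blast
    moreover have "u - u div 4 = 3 * (u div 4) + u mod 4" for u :: nat
      using div_mult_mod_eq[of u 4] by linarith
    ultimately have "(3 * (s div 4) + s mod 4) mod 4 ^ r = (3 * (t div 4) + s mod 4) mod 4 ^ r"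
      using lev by simp
    then have "[3 * (s div 4) = 3 * (t div 4)] (mod 4 ^ r)"
      using cong_add_rcancel_nat unfolding cong_def by blast
    moreover have "coprime (3 :: nat) (4 ^ r)"
      using coprime_Suc_right_nat[of 3] by simp
    ultimately have "s div 4 mod 4 ^ r = t div 4 mod 4 ^ r"
      using cong_mult_lcancel_nat unfolding cong_def by blast
    then show ?thesis using lev by (simp add: mod_mult2_eq)
  qed
qed simp

lemma step_quad: "A \<subseteq> {..<2 * r} \<Longrightarrow> step r (A \<union> quad r n) = A \<union> quad r (Suc n)"
proof -
  assume A: "A \<subseteq> {..<2 * r}"
  then have "2 * r \<notin> A" "Suc (2 * r) \<notin> A" by auto
  have "n mod 4 = 0 \<or> n mod 4 = 1 \<or> n mod 4 = 2 \<or> n mod 4 = 3" by linarith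
  then have "coord r (quad r n) \<in> {2 * r, Suc (2 * r)}"
    and "tog (coord r (quad r n)) (quad r n) = quad r (Suc n)"
    by (elim disjE; force simp: coord_def quad_def mod_Suc)+
  moreover have "coord r (A \<union> quad r n) = coord r (quad r n)"
    using \<open>2 * r \<notin> A\<close> \<open>Suc (2 * r) \<notin> A\<close> by (simp add: coord_def)
  moreover have "tog c (A \<union> quad r n) = A \<union> tog c (quad r n)" if "c \<notin> A" for c
    using that by auto
  ultimately show ?thesis
    using \<open>2 * r \<notin> A\<close> \<open>Suc (2 * r) \<notin> A\<close> unfolding step_def by (metis insertE singletonD)
qed

lemma rotor_orbit: "0 < r \<Longrightarrow> rotor r 0 (orbit r t) = orbit r (Suc t)"
proof (induction r arbitrary: t)
  case (Suc r)
  show ?case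
  proof (cases "r = 0")
    case True then show ?thesis using step_quad[of "{}" 0 t] by (simp add: rotor_def)
  next
    case False
    let ?A = "orbit r (t - t div 4)" and ?X = "orbit (Suc r) t"
    have lev: "level (Suc r) ?X mod 4 = t mod 4" by (rule level_orbit) simp
    have X: "?X = ?A \<union> quad r (t div 4)" using False by simp
    show ?thesis
    proof (cases "t mod 4 = 3")
      case True
      then have "Suc t div 4 = Suc (t div 4)" "Suc t - Suc t div 4 = t - t div 4"
        by (simp_all add: div_Suc mod_Suc)
      then show ?thesis
        using True lev False step_quad[OF orbit_subset] by (simp add: rotor_def del: orbit.simps add: orbit.simps(2))
    next
      \<comment> \<open>The new factor stands still, so its part is a translation that commutes with
        the old rotor.\<close>
      case 3: False
      then have t: "Suc t div 4 = t div 4" "Suc t - Suc t div 4 = Suc (t - t div 4)"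
        by (simp_all add: div_Suc mod_Suc Suc_diff_le)
      have Q: "quad r (t div 4) \<inter> {..<2 * r} = {}" by (rule quad_disjoint)
      have fl: "B \<union> quad r (t div 4) = flip (quad r (t div 4)) B" if "B \<subseteq> {..<2 * r}" for B
        using that Q by auto
      have "rotor (Suc r) 0 ?X = rotor r 0 ?X"
        using 3 lev by (simp add: rotor_def del: orbit.simps)
      also have "\<dots> = flip (quad r (t div 4)) (rotor r 0 ?A)"
        unfolding X fl[OF orbit_subset] using rotor_flip[OF _ Q] False by simp
      also have "\<dots> = orbit (Suc r) (Suc t)"
        using Suc.IH[of "t - t div 4"] False t fl[OF orbit_subset] by simp
      finally show ?thesis .
    qed
  qed
qed simp

lemma orbit_surj:
  assumes "0 < r" "A \<subseteq> {..<2 * r}"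
  obtains t where "t < 4 ^ r" "orbit r t = A"
proof -
  have "inj_on (orbit r) {..<4 ^ r}"
  proof (rule inj_onI)
    fix s t assume "s \<in> {..<4 ^ r}" "t \<in> {..<4 ^ r}" and "orbit r s = orbit r t"
    then show "s = t" using orbit_inj[OF assms(1), of s t] by simp
  qed
  then have "card (orbit r ` {..<4 ^ r}) = 4 ^ r" by (simp add: card_image)
  also have "(4 :: nat) ^ r = 2 ^ (2 * r)" by (simp add: power_mult)
  also have "\<dots> = card (Pow {..<2 * r})" by (simp add: card_Pow)
  finally have card: "card (orbit r ` {..<4 ^ r}) = card (Pow {..<2 * r})" .
  have "orbit r ` {..<4 ^ r} \<subseteq> Pow {..<2 * r}" using orbit_subset by blast
  from card_subset_eq[OF _ this card] have "orbit r ` {..<4 ^ r} = Pow {..<2 * r}" by simp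
  then show ?thesis using assms(2) that by (metis PowI imageE lessThan_iff)
qed

section \<open>Paths of length a power of two\<close>

text \<open>Coordinates below \<open>2 r\<close> are moved by the rotors, the others are toggled one at a time; the
  parity of the number of ones among the latter splits the vertices into two sides. A walk
  of length \<open>M\<close> starts at every vertex of the even side and makes the moves
  rotor 0, rotor 1, \<open>2 r\<close>, rotor 1, \<open>2 r + 1\<close>, rotor 2, \<open>2 r + 2\<close>, rotor 2, and so on; once
  the rotors are exhausted toggles the remaining coordinates up to \<open>M\<close>. Since each rotor
  \<open>k > 0\<close> is applied once on either side, only the coordinates above \<open>M\<close> and rotor 0 on
  the odd side are left. These are covered by closed trails: toggle \<open>M + 1, \<dots>, e - 1\<close> in turn,
  apply rotor 0, and repeat \<open>4 ^ r\<close> times.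

  \<open>bags r t\<close> is the number of coordinates toggled by a walk before time \<open>t\<close>, and
  \<open>trail r M e Y j i\<close> is the position on the trail through \<open>Y\<close> after \<open>j\<close> rounds and
  \<open>i\<close> toggles.\<close>

definition bags :: "nat \<Rightarrow> nat \<Rightarrow> nat" where
  "bags r t = (if t \<le> 4 * r - 3 then (t - 1) div 2 else t - (2 * r - 1))"

definition move :: "nat \<Rightarrow> nat \<Rightarrow> nat set \<Rightarrow> nat set" where
  "move r t X = (if t = 0 then rotor r 0 X
     else if odd t \<and> t < 4 * r - 3 then rotor r (Suc ((t - 1) div 4)) X
     else tog (2 * r + bags r t) X)"

primrec walk :: "nat \<Rightarrow> nat set \<Rightarrow> nat \<Rightarrow> nat set" where
  "walk r X 0 = X"
| "walk r X (Suc t) = move r t (walk r X t)"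

definition trail :: "nat \<Rightarrow> nat \<Rightarrow> nat \<Rightarrow> nat set \<Rightarrow> nat \<Rightarrow> nat \<Rightarrow> nat set" where
  "trail r M e Y j i = flip (orbit r j) (flip (if odd j then {M + 1..<e} else {}) (flip {M + 1..<M + 1 + i} Y))"

text \<open>Within a parity class, membership of \<open>a\<close> can be recovered from the rest of
  the set. The starting points of walks and of trails are both counted this way.\<close>

lemma card_parity_le:
  assumes "finite A" "a \<in> A" "a \<in> H"
  shows "card {X. X \<subseteq> A \<and> even (card (X \<inter> H)) = c} \<le> 2 ^ (card A - 1)"
proof -
  let ?S = "{X. X \<subseteq> A \<and> even (card (X \<inter> H)) = c}"
  have "inj_on (\<lambda>X. X - {a}) ?S"
  proof (rule inj_onI)
    fix X Y assume X: "X \<in> ?S" and Y: "Y \<in> ?S" and eq: "X - {a} = Y - {a}"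
    have par: "card (Z \<inter> H) = card ((Z - {a}) \<inter> H) + (if a \<in> Z then 1 else 0)" if "Z \<subseteq> A" for Z
    proof (cases "a \<in> Z")
      case True
      have "finite (Z \<inter> H)" "a \<in> Z \<inter> H" using that assms True by (auto intro: finite_subset)
      then have "card (Z \<inter> H) = Suc (card (Z \<inter> H - {a}))" by (rule card.remove)
      also have "Z \<inter> H - {a} = (Z - {a}) \<inter> H" by auto
      finally show ?thesis using True by simp
    qed simp
    have "X \<subseteq> A" "Y \<subseteq> A" and even: "even (card (X \<inter> H)) = even (card (Y \<inter> H))"
      using X Y by simp_all
    have "card ((X - {a}) \<inter> H) = card ((Y - {a}) \<inter> H)" by (simp only: eq)
    then have "(a \<in> X) = (a \<in> Y)"
      using even unfolding par[OF \<open>X \<subseteq> A\<close>] par[OF \<open>Y \<subseteq> A\<close>]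
      by (cases "a \<in> X"; cases "a \<in> Y"; simp)
    then show "X = Y" using eq by blast
  qed
  moreover have "(\<lambda>X. X - {a}) ` ?S \<subseteq> Pow (A - {a})" by auto
  moreover have "finite (Pow (A - {a}))" using assms by simp
  ultimately have "card ?S \<le> card (Pow (A - {a}))"
    by (rule card_inj_on_le)
  then show ?thesis using assms by (simp add: card_Pow)
qed

lemma edge_parity:
  assumes "X \<subseteq> {..<n}" "j < n" "l \<le> j"
  obtains W where "W \<subseteq> {..<n}" "{X, tog j X} = {W, tog j W}" "even (card (W - {..<l})) = c"
proof (cases "even (card (X - {..<l})) = c")
  case True then show ?thesis using that assms by blast
next
  case False
  have "tog j X - {..<l} = tog j (X - {..<l})" using assms by auto
  moreover have "finite X" using assms(1) by (rule finite_subset) simp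
  ultimately have "even (card (tog j X - {..<l})) = c" using False by (simp add: even_card_flip)
  moreover have "tog j X \<subseteq> {..<n}" using assms by auto
  ultimately show ?thesis using that[OF _ edge_sym] by blast
qed

lemma div_4_bound: "odd t \<Longrightarrow> t < 4 * r - 3 \<Longrightarrow> Suc ((t - 1) div 4) < r"
  by (elim oddE) auto

text \<open>Rotors act at time 0 and at the \<open>2 * r - 2\<close> odd times below
  \<open>4 * r - 3\<close>; these \<open>2 * r - 1\<close> moves are the offset in the late phase of
  \<open>bags\<close>.\<close>

lemma bags_Suc:
  assumes "0 < r"
  shows "bags r (Suc t) = bags r t + (if t = 0 \<or> odd t \<and> t < 4 * r - 3 then 0 else 1)"
proof -
  consider "t = 0" | "t > 0" "t < 4 * r - 3" | "t = 4 * r - 3" "t > 0" | "t > 4 * r - 3" by linarith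
  then show ?thesis
  proof cases
    case 1 then show ?thesis using assms by (auto simp: bags_def)
  next
    case 2
    then show ?thesis by (cases "even t") (auto simp: bags_def elim!: evenE oddE)
  next
    case 3
    then have "(t - 1) div 2 = 2 * r - 2" using assms by auto
    then show ?thesis using 3 assms by (auto simp: bags_def)
  next
    case 4
    then show ?thesis using assms by (auto simp: bags_def)
  qed
qed

lemma bags_mono: "0 < r \<Longrightarrow> s \<le> t \<Longrightarrow> bags r s \<le> bags r t"
  by (rule lift_Suc_mono_le[of "bags r"]) (simp_all add: bags_Suc)

text \<open>At most two rotor moves are consecutive, which can happen only at times 0 and 1.\<close>

lemma bags_less: "0 < r \<Longrightarrow> bags r t < bags r (t + 3)"
  using bags_Suc[of r t] bags_Suc[of r "t + 1"] bags_Suc[of r "t + 2"]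
  by (cases "t = 0"; cases "even t") (auto simp: numeral_3_eq_3 split: if_splits)

lemma move_rotor:
  assumes "0 < r" "t = 0 \<or> odd t \<and> t < 4 * r - 3"
  obtains k where "k < r" "move r t = rotor r k"
proof (cases "t = 0")
  case True
  then have "move r t = rotor r 0" by (simp add: fun_eq_iff move_def)
  then show ?thesis using that assms(1) by blast
next
  case False
  then have "move r t = rotor r (Suc ((t - 1) div 4))" using assms by (simp add: fun_eq_iff move_def)
  then show ?thesis using that div_4_bound assms False by blast
qed

lemma move_tog: "\<not> (t = 0 \<or> odd t \<and> t < 4 * r - 3) \<Longrightarrow> move r t = tog (2 * r + bags r t)"
  unfolding move_def fun_eq_iff by metis

lemma walk_diff: "0 < r \<Longrightarrow> walk r X t - {..<2 * r} = flip {2 * r..<2 * r + bags r t} (X - {..<2 * r})"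
proof (induction t)
  case 0
  then show ?case by (simp add: bags_def)
next
  case (Suc t)
  show ?case
  proof (cases "t = 0 \<or> odd t \<and> t < 4 * r - 3")
    case True
    then have "walk r X (Suc t) - {..<2 * r} = walk r X t - {..<2 * r}"
      using rotor_diff[OF Suc.prems] rotor_diff[OF div_4_bound] by (auto simp: move_def)
    then show ?thesis using Suc True bags_Suc[of r t] by auto
  next
    case False
    then have "walk r X (Suc t) - {..<2 * r} = tog (2 * r + bags r t) (walk r X t - {..<2 * r})"
      by (auto simp: move_def)
    also have "\<dots> = tog (2 * r + bags r t) (flip {2 * r..<2 * r + bags r t} (X - {..<2 * r}))"
      using Suc by simp
    also have "\<dots> = flip {2 * r..<2 * r + bags r (Suc t)} (X - {..<2 * r})"
      using False bags_Suc[OF Suc.prems, of t] by (auto simp: less_Suc_eq)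
    finally show ?thesis .
  qed
qed

text \<open>A rotor raises the level and a toggle raises \<open>bags\<close>, so their sum is a
  clock modulo 4.\<close>

lemma level_walk: "0 < r \<Longrightarrow> (level r (walk r X t) + bags r t) mod 4 = (level r X + t) mod 4"
proof (induction t)
  case 0
  then show ?case by (simp add: bags_def)
next
  case (Suc t)
  have IH: "Suc (level r (walk r X t) + bags r t) mod 4 = Suc (level r X + t) mod 4"
    using Suc by (metis mod_Suc_eq)
  show ?case
  proof (cases "t = 0 \<or> odd t \<and> t < 4 * r - 3")
    case True
    then have "level r (walk r X (Suc t)) mod 4 = Suc (level r (walk r X t)) mod 4"
      using level_rotor[OF Suc.prems] level_rotor[OF div_4_bound] by (auto simp: move_def)
    then have "(level r (walk r X (Suc t)) + bags r t) mod 4 = (Suc (level r (walk r X t)) + bags r t) mod 4"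
      by (metis mod_add_left_eq)
    then show ?thesis using True IH bags_Suc[OF Suc.prems, of t] by simp
  next
    case False
    then have "walk r X (Suc t) \<inter> {..<2 * r} = walk r X t \<inter> {..<2 * r}"
      by (auto simp: move_def)
    then have "level r (walk r X (Suc t)) = level r (walk r X t)" by (rule level_cong)
    then show ?thesis using IH bags_Suc[OF Suc.prems, of t] False by simp
  qed
qed

text \<open>No coordinate is toggled twice, so equal vertices have equal \<open>bags\<close> and
  their times differ by at most 2; the clock then forces the times to agree.\<close>

lemma inj_walk:
  assumes "0 < r"
  shows "inj (walk r X)"
proof -
  have *: "s = t" if "walk r X s = walk r X t" "s \<le> t" for s t
  proof -
    have "{2 * r..<2 * r + bags r s} = {2 * r..<2 * r + bags r t}"
    proof -
      have "flip {2 * r..<2 * r + bags r s} (X - {..<2 * r}) = flip {2 * r..<2 * r + bags r t} (X - {..<2 * r})"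
        using walk_diff[OF assms, of X] that(1) by metis
      then show ?thesis by (simp only: flip_inject_left)
    qed
    then have bags: "bags r s = bags r t"
      by (metis card_atLeastLessThan diff_add_inverse)
    have "t < s + 3"
      using bags bags_mono[OF assms, of "s + 3" t] bags_less[OF assms, of s] by linarith
    moreover have "(level r X + s) mod 4 = (level r X + t) mod 4"
      using level_walk[OF assms, of X] bags that(1) by metis
    then have "4 dvd t - s"
      using that(2) by (metis add_diff_cancel_left mod_eq_dvd_iff_nat add_le_cancel_left)
    then obtain k where "t - s = 4 * k" by (rule dvdE)
    ultimately show ?thesis using that(2) by (cases k) auto
  qed
  show ?thesis
    using * by (intro injI) (metis nat_le_linear)
qed

section \<open>Even length M below an odd dimension e: walks and trails\<close>

context
  fixes r M e :: nat
  assumes r: "0 < r" and M_low: "4 * r - 4 \<le> M" "2 * r \<le> M" and even_M: "even M" 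
    and M_dvd: "M dvd 4 ^ r" and M_less: "M < 4 ^ r" and odd_e: "odd e" and M_e: "M < e"
begin

text \<open>The \<open>2 * r - 1\<close> rotor moves all happen within \<open>M\<close> moves, so
  \<open>M + 1 - 2 * r\<close> toggles remain, and the last one concerns coordinate
  \<open>M\<close>.\<close>

lemma bags_bound:
  assumes t: "t < M" "t \<noteq> 0" "\<not> (odd t \<and> t < 4 * r - 3)"
  shows "2 * r + bags r t \<le> M"
proof -
  obtain m where m: "M = 2 * m" using even_M by (rule evenE)
  have m_low: "2 * r \<le> m + 2" using M_low m by simp
  show ?thesis
  proof (cases "4 * r \<le> t + 2")
    case True
    then have "bags r t + 2 * r = t + 1" using r by (simp add: bags_def)
    then show ?thesis using t(1) by simp
  next
    case False
    show ?thesis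
    proof (cases "even t")
      case True
      then obtain l where l: "t = 2 * l" by (rule evenE)
      then obtain k where k: "l = Suc k" using t(2) by (cases l) auto
      then have "bags r t = k" using False l by (simp add: bags_def)
      moreover have "l < m" using t(1) l m by simp
      ultimately show ?thesis using k m m_low by simp
    next
      case odd: False
      then obtain l where l: "t = 2 * l + 1" by (rule oddE)
      then have "l + 2 = 2 * r" using t(3) False by simp
      moreover have "bags r t = l" using False l by (simp add: bags_def)
      moreover have "l < m" using t(1) l m by simp
      ultimately show ?thesis using m m_low by simp
    qed
  qed
qed

text \<open>Every move permutes the finite set of vertices, so a walk can be traced back from any
  vertex and any time up to \<open>M\<close>.\<close>

lemma walk_surj: "t \<le> M \<Longrightarrow> Z \<subseteq> {..<e} \<Longrightarrow> \<exists>X \<subseteq> {..<e}. walk r X t = Z"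
proof (induction t arbitrary: Z)
  case 0
  then show ?case by (metis walk.simps(1))
next
  case (Suc t)
  have "inj (move r t) \<and> move r t ` Pow {..<e} \<subseteq> Pow {..<e}"
  proof (cases "t = 0 \<or> odd t \<and> t < 4 * r - 3")
    case True
    obtain k where k: "k < r" "move r t = rotor r k" using move_rotor[OF r True] by blast
    have low: "{..<2 * r} \<subseteq> {..<e}" using M_low M_e by simp
    have "rotor r k X \<in> Pow {..<e}" if "X \<in> Pow {..<e}" for X
      using rotor_subset[OF k(1) PowD[OF that] low] by (rule PowI)
    moreover have "inj (rotor r k)" using rotor_inject[OF k(1)] by (rule injI)
    ultimately show ?thesis unfolding k(2) by blast
  next
    case False
    then have "2 * r + bags r t < e" using bags_bound[of t] Suc.prems(1) M_e by linarith
    then have "tog (2 * r + bags r t) X \<in> Pow {..<e}" if "X \<in> Pow {..<e}" for X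
      using PowD[OF that] by (intro PowI flip_subset) simp_all
    moreover have "inj (tog (2 * r + bags r t))" by (rule injI) (simp only: flip_inject)
    ultimately show ?thesis unfolding move_tog[OF False] by blast
  qed
  then have "inj (move r t)" and "move r t ` Pow {..<e} \<subseteq> Pow {..<e}" by blast+
  from \<open>inj (move r t)\<close> have "inj_on (move r t) (Pow {..<e})" by (rule inj_on_subset) simp
  with \<open>move r t ` Pow {..<e} \<subseteq> Pow {..<e}\<close> have "move r t ` Pow {..<e} = Pow {..<e}"
    by (intro endo_inj_surj) simp_all
  then have "Z \<in> move r t ` Pow {..<e}" using Suc.prems(2) by simp
  then obtain W where W: "W \<subseteq> {..<e}" "move r t W = Z" by (elim imageE) simp
  obtain X where X: "X \<subseteq> {..<e}" "walk r X t = W"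
    using Suc.IH[OF Suc_leD[OF Suc.prems(1)] W(1)] by blast
  have "walk r X (Suc t) = Z" unfolding walk.simps X(2) W(2) ..
  then show ?case using X(1) by blast
qed

lemma trail_Int: "Y \<subseteq> {2 * r..<e} \<Longrightarrow> trail r M e Y j i \<inter> {..<2 * r} = orbit r j"
  and trail_diff: "Y \<subseteq> {2 * r..<e} \<Longrightarrow> trail r M e Y j i - {..<2 * r} =
     flip (if odd j then {M + 1..<e} else {}) (flip {M + 1..<M + 1 + i} Y)"
proof -
  assume Y: "Y \<subseteq> {2 * r..<e}"
  let ?H = "flip (if odd j then {M + 1..<e} else {}) (flip {M + 1..<M + 1 + i} Y)"
  have "?H \<inter> {..<2 * r} = {}" using Y M_low by (cases "odd j") auto
  from flip_Int_Diff[OF orbit_subset this]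
  show "trail r M e Y j i \<inter> {..<2 * r} = orbit r j" "trail r M e Y j i - {..<2 * r} = ?H"
    by (simp_all only: trail_def)
qed

lemma trail_tog: "trail r M e Y j (Suc i) = tog (M + 1 + i) (trail r M e Y j i)"
  unfolding trail_def by (auto simp: less_Suc_eq)

text \<open>At the end of a round all coordinates above \<open>M\<close> have been flipped; the term
  for odd \<open>j\<close> in \<open>trail\<close> records this.\<close>

lemma trail_rotor:
  assumes "Y \<subseteq> {2 * r..<e}"
  shows "rotor r 0 (trail r M e Y j (e - M - 1)) = trail r M e Y (Suc j) 0"
proof -
  let ?A = "flip (if odd j then {M + 1..<e} else {}) (flip {M + 1..<M + 1 + (e - M - 1)} Y)"
  let ?B = "flip (if odd (Suc j) then {M + 1..<e} else {}) (flip {M + 1..<M + 1 + 0} Y)"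
  have "M + 1 + (e - M - 1) = e" using M_e by simp
  then have A: "?A = ?B" by (cases "odd j") (simp_all only: if_True if_False even_Suc not_not, auto)
  have "?B \<inter> {..<2 * r} = {}" using assms M_low by (cases "odd j") auto
  then have "rotor r 0 (flip ?B (orbit r j)) = flip ?B (orbit r (Suc j))"
    using rotor_flip[OF r] rotor_orbit[OF r] by metis
  then show ?thesis
    unfolding trail_def A by (simp only: flip_commute[of "orbit _ _"])
qed

text \<open>The low coordinates determine the round modulo \<open>4 ^ r\<close>, and the bounds keep
  the two rounds less than \<open>4 ^ r\<close> apart.\<close>

lemma trail_inject:
  assumes Y: "Y \<subseteq> {2 * r..<e}" and eq: "trail r M e Y j i = trail r M e Y j' i'"
    and near: "j \<le> j' + M" "j' \<le> j + M"
  shows "j = j' \<and> i = i'"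
proof
  have "orbit r j = orbit r j'" using trail_Int[OF Y] eq by metis
  then have "j mod 4 ^ r = j' mod 4 ^ r" by (rule orbit_inj[OF r])
  moreover have "j < j' + 4 ^ r" "j' < j + 4 ^ r" using near M_less by auto
  ultimately show jj: "j = j'"
    by (metis add.commute le_add_diff_inverse less_diff_conv2 mod_eq_dvd_iff_nat nat_dvd_not_less nat_le_linear
        zero_less_diff le_neq_implies_less)
  have "flip {M + 1..<M + 1 + i} Y = flip {M + 1..<M + 1 + i'} Y"
    using trail_diff[OF Y, of j i] trail_diff[OF Y, of j' i'] eq jj by simp
  then have "{M + 1..<M + 1 + i} = {M + 1..<M + 1 + i'}" by (simp only: flip_inject_left)
  then show "i = i'" by (metis card_atLeastLessThan diff_add_inverse)
qed

lemma walk_parity: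
  assumes "X \<subseteq> {..<e}"
  shows "even (card (X - {..<2 * r})) \<longleftrightarrow>
    (even (card (walk r X t - {..<2 * r})) \<longleftrightarrow> even (bags r t))"
proof -
  have "finite X" using assms by (rule finite_subset) simp
  then show ?thesis
    unfolding walk_diff[OF r] by (subst even_card_flip) auto
qed

text \<open>Undoing the flips of \<open>trail\<close> yields \<open>Y\<close>. The full block above
  \<open>M\<close> has the even size \<open>e - M - 1\<close>, so only the \<open>i\<close> toggles
  affect the side, and \<open>Y\<close> comes out odd.\<close>

lemma trail_exists:
  assumes W: "W \<subseteq> {..<e}" and i: "i < e - M"
    and par: "even (card (W - {..<2 * r})) \<longleftrightarrow> odd i"
  obtains Y j where "Y \<subseteq> {2 * r..<e}" "odd (card Y)" "j < 4 ^ r" "trail r M e Y j i = W"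
proof -
  obtain j where j: "j < 4 ^ r" "orbit r j = W \<inter> {..<2 * r}"
    using orbit_surj[OF r, of "W \<inter> {..<2 * r}"] by blast
  define F where "F = (if odd j then {M + 1..<e} else {})"
  let ?F = F and ?P = "{M + 1..<M + 1 + i}"
  define Y where "Y = flip ?P (flip ?F (W - {..<2 * r}))"
  have "finite W" using W by (rule finite_subset) simp
  moreover have "finite ?F" "even (card ?F)" using odd_e even_M M_e by (auto simp: F_def)
  moreover have "card ?P = i" by simp
  ultimately have "odd (card Y)" unfolding Y_def using par by (simp add: even_card_flip)
  moreover have "Y \<subseteq> {2 * r..<e}"
    using W i M_low unfolding Y_def F_def by (cases "odd j") auto
  moreover have "flip ?F (flip ?P Y) = W - {..<2 * r}" by (simp add: Y_def)
  then have "trail r M e Y j i = W"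
    unfolding trail_def F_def[symmetric] using j by auto
  ultimately show ?thesis using that j by blast
qed

text \<open>The bounds \<open>M \<ge> 4 r - 4\<close> and \<open>M < 4 ^ r\<close> make the walks long enough to use all rotors
  twice and the pieces of the trails short enough not to close up.\<close>

definition walks :: "(nat \<Rightarrow> nat set) set" where
  "walks = walk r ` {X. X \<subseteq> {..<e} \<and> even (card (X \<inter> - {..<2 * r})) = True}"

text \<open>Time \<open>s * M + t\<close> on a trail is split into full rounds of
  \<open>e - M\<close> moves and a remainder. The parity condition is spelled as in
  \<open>card_parity_le\<close>.\<close>

definition pieces :: "(nat \<Rightarrow> nat set) set" where
  "pieces = (\<lambda>(Y, s) t. trail r M e Y ((s * M + t) div (e - M)) ((s * M + t) mod (e - M))) `
     ({Y. Y \<subseteq> {2 * r..<e} \<and> even (card (Y \<inter> UNIV)) = False} \<times> {..<4 ^ r * (e - M) div M})"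

lemma walks_edge:
  assumes W: "W \<subseteq> {..<e}" and t: "t < M"
    and par: "even (card (W - {..<2 * r})) \<longleftrightarrow> even (bags r t)"
  shows "\<exists>p\<in>walks. p t = W \<and> p (Suc t) = move r t W"
proof -
  obtain X where X: "X \<subseteq> {..<e}" "walk r X t = W"
    using walk_surj[of t W] W t by auto
  then have "even (card (X - {..<2 * r}))" using walk_parity[OF X(1), of t] par by simp
  then show ?thesis
    using X unfolding walks_def by (intro bexI[of _ "walk r X"]) (auto simp: Diff_eq)
qed

lemma pieces_edge:
  assumes Y: "Y \<subseteq> {2 * r..<e}" "odd (card Y)" and j: "j < 4 ^ r" and i: "i < e - M"
  shows "\<exists>p\<in>pieces. \<exists>t<M. p t = trail r M e Y j i \<and> p (Suc t) =
    (if Suc i < e - M then trail r M e Y j (Suc i) else trail r M e Y (Suc j) 0)"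
proof -
  \<comment> \<open>\<open>?u\<close> is the time on the trail; division by \<open>M\<close> gives
    the piece and the place in it. The next vertex may belong to round \<open>4 ^ r\<close>, as the
    formula for \<open>trail\<close> is never reduced modulo the length of the trail.\<close>
  let ?f = "e - M" and ?u = "j * (e - M) + i"
  have M0: "0 < M" using M_low r by linarith
  have dm: "?u div ?f = j" "?u mod ?f = i" using i by auto
  have "?u < Suc j * ?f" using i by simp
  also have "\<dots> \<le> 4 ^ r * ?f" using j by (intro mult_le_mono) auto
  finally have "?u < 4 ^ r * ?f" .
  moreover have "M dvd 4 ^ r * ?f" using M_dvd by simp
  ultimately have s: "?u div M < 4 ^ r * ?f div M"
    using M0 by (simp add: div_less_iff_less_mult)
  let ?p = "\<lambda>t. trail r M e Y ((?u div M * M + t) div ?f) ((?u div M * M + t) mod ?f)"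
  have "?p \<in> pieces"
    unfolding pieces_def using Y s by (intro image_eqI[of _ _ "(Y, ?u div M)"]) auto
  moreover have "?p (?u mod M) = trail r M e Y j i" using dm by (simp only: div_mult_mod_eq)
  moreover have "?u div M * M + Suc (?u mod M) = Suc ?u" by (simp only: add_Suc_right div_mult_mod_eq)
  moreover have "Suc ?u div ?f = (if Suc i < ?f then j else Suc j)"
    "Suc ?u mod ?f = (if Suc i < ?f then Suc i else 0)"
    using dm i by (simp_all only: div_Suc mod_Suc) auto
  ultimately show ?thesis
    using M0 by (intro bexI[of _ ?p] exI[of _ "?u mod M"]) auto
qed

lemma inj_on_pieces: "p \<in> pieces \<Longrightarrow> inj_on p {..M}"
proof (rule inj_onI)
  fix t t' assume p: "p \<in> pieces" and t: "t \<in> {..M}" "t' \<in> {..M}" and eq: "p t = p t'"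
  let ?f = "e - M"
  from p obtain Y s where Y: "Y \<subseteq> {2 * r..<e}"
    and ps: "p = (\<lambda>t. trail r M e Y ((s * M + t) div ?f) ((s * M + t) mod ?f))"
    unfolding pieces_def by auto
  \<comment> \<open>Every round has at least one move, so \<open>M\<close> moves advance by at most
    \<open>M\<close> rounds.\<close>
  have near: "(s * M + a) div ?f \<le> (s * M + b) div ?f + M" if "a \<le> M" for a b
  proof -
    have "(s * M + a) div ?f \<le> (s * M + M * ?f) div ?f"
    proof (intro div_le_mono add_left_mono)
      have "M * 1 \<le> M * ?f" using M_e by (intro mult_le_mono2) simp
      then show "a \<le> M * ?f" using that by linarith
    qed
    also have "\<dots> = s * M div ?f + M" using M_e by simp
    also have "\<dots> \<le> (s * M + b) div ?f + M" by (intro add_right_mono div_le_mono) simp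
    finally show ?thesis .
  qed
  have "(s * M + t) div ?f = (s * M + t') div ?f \<and> (s * M + t) mod ?f = (s * M + t') mod ?f"
    using eq t near unfolding ps by (intro trail_inject[OF Y]) auto
  then have "s * M + t = s * M + t'" by (metis div_mult_mod_eq)
  then show "t = t'" by simp
qed

lemma finite_walks: "finite walks" and card_walks: "card walks \<le> 2 ^ (e - 1)"
proof -
  let ?S = "{X. X \<subseteq> {..<e} \<and> even (card (X \<inter> - {..<2 * r})) = True}"
  have fin: "finite ?S" by (rule finite_subset[of _ "Pow {..<e}"]) auto
  then show "finite walks" unfolding walks_def by (rule finite_imageI)
  have "card walks \<le> card ?S" unfolding walks_def using fin by (rule card_image_le)
  also have "\<dots> \<le> 2 ^ (card {..<e} - 1)"
    using M_low M_e by (intro card_parity_le[of _ "e - 1"]) auto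
  finally show "card walks \<le> 2 ^ (e - 1)" by simp
qed

lemma finite_pieces: "finite pieces"
  and card_pieces: "card pieces * M \<le> 2 ^ (e - 1) * (e - M)"
proof -
  let ?S = "{Y. Y \<subseteq> {2 * r..<e} \<and> even (card (Y \<inter> UNIV)) = False}"
  let ?n = "4 ^ r * (e - M) div M"
  have fin: "finite ?S" by (rule finite_subset[of _ "Pow {..<e}"]) auto
  then show "finite pieces" unfolding pieces_def by (intro finite_imageI finite_cartesian_product) auto
  have "card pieces \<le> card (?S \<times> {..<?n})"
    unfolding pieces_def using fin by (intro card_image_le finite_cartesian_product) auto
  also have "\<dots> = card ?S * ?n" by (simp add: card_cartesian_product)
  also have "\<dots> \<le> 2 ^ (card {2 * r..<e} - 1) * ?n"
    using M_low M_e by (intro mult_right_mono card_parity_le[of _ "e - 1"]) auto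
  finally have "card pieces * M \<le> 2 ^ (card {2 * r..<e} - 1) * ?n * M" by (rule mult_right_mono) simp
  also have "\<dots> \<le> 2 ^ (e - 2 * r - 1) * (4 ^ r * (e - M))"
    using div_times_less_eq_dividend[of "4 ^ r * (e - M)" M] by (simp add: mult.assoc)
  also have "\<dots> = 2 ^ (e - 2 * r - 1 + 2 * r) * (e - M)"
    by (simp add: power_add power_mult)
  also have "e - 2 * r - 1 + 2 * r = e - 1" using M_low M_e by linarith
  finally show "card pieces * M \<le> 2 ^ (e - 1) * (e - M)" .
qed

text \<open>Toggle number \<open>c\<close>, counted from 0, happens at time \<open>2 * c + 2\<close>
  while toggles alternate with rotors, and at time \<open>c + 2 * r - 1\<close> afterwards.\<close>

lemma bags_time:
  assumes "c < M + 1 - 2 * r"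
  obtains t where "0 < t" "t < M" "\<not> (odd t \<and> t < 4 * r - 3)" "bags r t = c"
proof (cases "c + 4 \<le> 2 * r")
  case True
  then show ?thesis using that[of "2 * c + 2"] M_low by (auto simp: bags_def)
next
  case False
  show ?thesis
  proof (cases "c + 3 = 2 * r")
    \<comment> \<open>Now the time is \<open>4 * r - 4\<close>, and it is the bound on
      \<open>c\<close> that puts it below \<open>M\<close>.\<close>
    case True
    then have "even (2 * c + 2)" "bags r (2 * c + 2) = c" "2 * c + 2 < M"
      using assms M_low by (auto simp: bags_def)
    then show ?thesis using that[of "2 * c + 2"] by simp
  next
    case c: False
    have "bags r (c + 2 * r - 1) = c"
    proof (cases "c + 2 * r - 1 \<le> 4 * r - 3")
      case True
      then have "c + 2 * r - 1 = 4 * r - 3" "c = 2 * r - 2" using c False r by auto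
      then show ?thesis by (auto simp: bags_def)
    next
      case False
      moreover have "c + 2 * r - 1 - (2 * r - 1) = c" using r by linarith
      ultimately show ?thesis by (simp only: bags_def if_False)
    qed
    moreover have "c + 2 * r - 1 < M" "0 < c + 2 * r - 1" "\<not> c + 2 * r - 1 < 4 * r - 3"
      using assms c False r by auto
    ultimately show ?thesis using that by blast
  qed
qed

text \<open>The two uses of rotor \<open>k\<close>, at times \<open>4 * (k - 1) + 1\<close> and
  \<open>4 * (k - 1) + 3\<close>, are separated by one toggle and so lie on opposite sides.\<close>

lemma rotor_time:
  assumes "0 < k" "k < r"
  obtains t where "t < M" "odd t" "t < 4 * r - 3" "Suc ((t - 1) div 4) = k" "even (bags r t) = c"
proof -
  obtain k' where k: "k = Suc k'" using assms by (cases k) auto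
  show ?thesis
  proof (cases c)
    case True
    then show ?thesis using that[of "4 * k' + 1"] k assms M_low by (auto simp: bags_def)
  next
    case False
    then show ?thesis using that[of "4 * k' + 3"] k assms M_low by (auto simp: bags_def)
  qed
qed

lemma path_dec_even: "path_dec M e"
proof (rule path_decI[of "walks \<union> pieces"])
  show "finite (walks \<union> pieces)" using finite_walks finite_pieces by simp
  show "inj_on p {..M}" if "p \<in> walks \<union> pieces" for p
    using that inj_on_pieces inj_walk[OF r] unfolding walks_def by (auto intro: inj_on_subset)
  have "card (walks \<union> pieces) * M \<le> (card walks + card pieces) * M"
    by (intro mult_right_mono card_Un_le) simp
  also have "\<dots> \<le> 2 ^ (e - 1) * M + 2 ^ (e - 1) * (e - M)"
    using card_walks card_pieces by (simp add: add_mult_distrib add_mono)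
  also have "\<dots> = e * 2 ^ (e - 1)" using M_e by (simp flip: add_mult_distrib2)
  finally show "card (walks \<union> pieces) * M \<le> e * 2 ^ (e - 1)" .
  fix X j assume X: "X \<subseteq> {..<e}" and j: "j < e"
  have rotX: "2 * r \<le> e" using M_low M_e by simp
  consider "j < 2 * r" | "2 * r \<le> j" "j \<le> M" | "M < j" by linarith
  then show "\<exists>p\<in>walks \<union> pieces. \<exists>i<M. {p i, p (Suc i)} = {X, tog j X}"
  proof cases
    case 1
    then obtain k W where kW: "k < r" "{X, tog j X} = {W, rotor r k W}" "W = X \<or> W = tog j X"
      using edge_rotor by metis
    then have W: "W \<subseteq> {..<e}" using X j by auto
    consider "0 < k" | "k = 0" "even (card (W - {..<2 * r}))" | "k = 0" "odd (card (W - {..<2 * r}))"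
      by blast
    then show ?thesis
    proof cases
      case 1
      then obtain t where t: "t < M" "odd t" "t < 4 * r - 3" "Suc ((t - 1) div 4) = k"
        "even (bags r t) = even (card (W - {..<2 * r}))"
        using rotor_time kW(1) by metis
      then obtain p where "p \<in> walks" "p t = W" "p (Suc t) = move r t W"
        using walks_edge[OF W t(1)] by auto
      moreover have "move r t W = rotor r k W" using t by (auto simp: move_def)
      ultimately show ?thesis using kW t(1) by (metis UnI1)
    next
      case 2
      have "0 < M" using M_low r by linarith
      then obtain p where "p \<in> walks" "p 0 = W" "p (Suc 0) = move r 0 W"
        using walks_edge[OF W, of 0] 2 by (auto simp: bags_def)
      moreover have "move r 0 W = rotor r k W" using 2 by (simp add: move_def)
      ultimately show ?thesis using kW \<open>0 < M\<close> by (metis UnI1)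
    next
      case 3
      \<comment> \<open>The last position of a round, just before rotor 0. It is reached after an
        even number of toggles, hence on the odd side, where the walks have left rotor 0.\<close>
      define i where "i = e - M - 1"
      have i: "even i" "i < e - M" "\<not> Suc i < e - M" using odd_e even_M M_e by (auto simp: i_def)
      then obtain Y l where Y: "Y \<subseteq> {2 * r..<e}" "odd (card Y)" "l < 4 ^ r"
        "trail r M e Y l i = W"
        using trail_exists[OF W i(2)] 3 i(1) by metis
      then obtain p t where "p \<in> pieces" "t < M" "p t = W" "p (Suc t) = trail r M e Y (Suc l) 0"
        using pieces_edge[OF Y(1-3), of i] i by auto
      moreover have "trail r M e Y (Suc l) 0 = rotor r k W"
        using trail_rotor[OF Y(1), of l] Y(4) 3 unfolding i_def by simp
      ultimately show ?thesis using kW by (metis UnI2)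
    qed
  next
    case 2
    then obtain t where t: "0 < t" "t < M" "\<not> (odd t \<and> t < 4 * r - 3)" "bags r t = j - 2 * r"
      using bags_time[of "j - 2 * r"] by (metis less_Suc_eq_le Suc_eq_plus1 diff_less_mono)
    obtain W where W: "W \<subseteq> {..<e}" "{X, tog j X} = {W, tog j W}"
      "even (card (W - {..<2 * r})) = even (bags r t)"
      using edge_parity[OF X j] 2 by metis
    then obtain p where "p \<in> walks" "p t = W" "p (Suc t) = move r t W"
      using walks_edge[OF W(1) t(2)] by auto
    moreover have "move r t W = tog j W" using t 2 by (auto simp: move_def)
    ultimately show ?thesis using W t(2) by (metis UnI1)
  next
    case 3
    define i where "i = j - M - 1"
    have i: "j = M + 1 + i" "Suc i < e - M" using 3 j by (auto simp: i_def)
    obtain W where W: "W \<subseteq> {..<e}" "{X, tog j X} = {W, tog j W}"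
      "even (card (W - {..<2 * r})) = odd i"
      using edge_parity[OF X j] 3 M_low by (metis less_imp_le_nat order.trans)
    then obtain Y l where Y: "Y \<subseteq> {2 * r..<e}" "odd (card Y)" "l < 4 ^ r" "trail r M e Y l i = W"
      using trail_exists[OF W(1) Suc_lessD[OF i(2)] W(3)] by metis
    then obtain p t where "p \<in> pieces" "t < M" "p t = W" "p (Suc t) = trail r M e Y l (Suc i)"
      using pieces_edge[OF Y(1-3), of i] i by auto
    moreover have "trail r M e Y l (Suc i) = tog j W" using trail_tog Y(4) i(1) by simp
    ultimately show ?thesis using W by (metis UnI2)
  qed
qed

end

section \<open>Paths of length one\<close>

lemma path_dec_1: "path_dec 1 n"
proof (rule path_decI)
  let ?A = "SIGMA j:{..<n}. Pow ({..<n} - {j})"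
  let ?S = "(\<lambda>(j, X) t :: nat. if t = 0 then X else tog j X) ` ?A"
  have fin: "finite ?A" by simp
  then show "finite ?S" by (rule finite_imageI)
  have "card ?S \<le> card ?A" using fin by (rule card_image_le)
  also have "\<dots> = n * 2 ^ (n - 1)"
    using bij_betw_same_card[OF bij_edges] card_cube_edges by simp
  finally show "card ?S * 1 \<le> n * 2 ^ (n - 1)" by simp
  show "inj_on p {..1}" if p: "p \<in> ?S" for p
  proof -
    obtain j X where pX: "p = (\<lambda>t. if t = 0 then X else tog j X)" using p by auto
    have "tog j X \<noteq> X" using mem_flip[of j "{j}" X] by blast
    then have "p 0 \<noteq> p 1" unfolding pX by simp
    moreover have "{..1 :: nat} = {0, 1}" by (simp add: atMost_Suc insert_commute)
    ultimately show ?thesis by simp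
  qed
  fix X j assume X: "X \<subseteq> {..<n}" "j < n"
  obtain W where W: "W \<subseteq> {..<n}" "{X, tog j X} = {W, tog j W}" "False = (j \<in> W)"
    by (rule edge_cases[OF X])
  let ?p = "\<lambda>t :: nat. if t = 0 then W else tog j W"
  have "?p \<in> ?S" using W X by (intro image_eqI[of _ _ "(j, W)"]) auto
  moreover have "{?p 0, ?p (Suc 0)} = {X, tog j X}" using W(2) by simp
  ultimately show "\<exists>p\<in>?S. \<exists>i<1. {p i, p (Suc i)} = {X, tog j X}"
    by (intro bexI[of _ ?p] exI[of _ 0] conjI) simp_all
qed

section \<open>Replacing coordinates by blocks\<close>

text \<open>An edge of the \<open>e\<close>-cube becomes a path of length \<open>d\<close> in the \<open>d e\<close>-cube that flips the
  coordinates of a block one after the other, in increasing order starting from the end with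
  an even number of ones in the block. As \<open>d\<close> is odd exactly one end is even, so both directions
  of traversal give the same path. The translates by the sets \<open>R\<close> that avoid the first coordinate
  of every block cover the \<open>d e\<close>-cube.\<close>

definition block :: "nat \<Rightarrow> nat \<Rightarrow> nat set" where
  "block d i = {i * d..<i * d + d}"

definition lift :: "nat \<Rightarrow> nat set \<Rightarrow> nat set" where
  "lift d P = {x. x div d \<in> P}"

definition dir :: "(nat \<Rightarrow> nat set) \<Rightarrow> nat \<Rightarrow> nat" where
  "dir p j = (THE i. p (Suc j) = tog i (p j))"

definition sweep :: "nat \<Rightarrow> nat \<Rightarrow> nat set \<Rightarrow> nat \<Rightarrow> nat set" where
  "sweep d i X s = (if even (card (X \<inter> block d i)) then {i * d..<i * d + s} else {i * d + d - s..<i * d + d})"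

text \<open>\<open>t div d\<close> selects the edge of \<open>p\<close> and \<open>t mod d\<close>
  the progress in its block. At the final time \<open>dir\<close> may be unspecified, but a sweep of
  length 0 is empty.\<close>

definition lifted :: "nat \<Rightarrow> nat set \<Rightarrow> (nat \<Rightarrow> nat set) \<Rightarrow> nat \<Rightarrow> nat set" where
  "lifted d R p t = (let X = flip R (lift d (p (t div d)))
     in flip (sweep d (dir p (t div d)) X (t mod d)) X)"

lemma mem_block: "0 < d \<Longrightarrow> x \<in> block d i \<longleftrightarrow> x div d = i"
proof -
  assume "0 < d"
  then have "x div d < Suc i \<longleftrightarrow> x < Suc i * d" "i \<le> x div d \<longleftrightarrow> i * d \<le> x"
    by (simp_all only: div_less_iff_less_mult less_eq_div_iff_mult_less_eq)
  then show ?thesis by (auto simp: block_def)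
qed

lemma lift_tog: "0 < d \<Longrightarrow> lift d (tog i P) = flip (block d i) (lift d P)"
  by (simp add: set_eq_iff lift_def mem_block)

lemma dir_eq: "p (Suc j) = tog i (p j) \<Longrightarrow> dir p j = i"
  unfolding dir_def by (rule the_equality) (auto simp: flip_inject_left)

lemma sweep_subset: "s \<le> d \<Longrightarrow> sweep d i X s \<subseteq> block d i"
  by (auto simp: sweep_def block_def)

lemma card_sweep: "s \<le> d \<Longrightarrow> card (sweep d i X s) = s"
  by (auto simp: sweep_def)

lemma sweep_0: "sweep d i X 0 = {}"
  by (simp add: sweep_def)

lemma sweep_full: "sweep d i X d = block d i"
  by (simp add: sweep_def block_def)

lemma lifted_mult: "0 < d \<Longrightarrow> lifted d R p (j * d) = flip R (lift d (p j))"
  by (simp add: lifted_def sweep_0)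

text \<open>Time \<open>s = d\<close> already belongs to the next edge; the formula persists because
  a full sweep is the lift of the toggle.\<close>

lemma lifted_eq:
  assumes d: "0 < d" and p: "p (Suc j) = tog i (p j)" and s: "s \<le> d"
  shows "lifted d R p (j * d + s) = flip (sweep d i (flip R (lift d (p j))) s) (flip R (lift d (p j)))"
proof (cases "s = d")
  case True
  have "j * d + s = Suc j * d" using True by simp
  then have "lifted d R p (j * d + s) = lifted d R p (Suc j * d)" by (simp only:)
  also have "\<dots> = flip R (lift d (p (Suc j)))" by (rule lifted_mult[OF d])
  also have "\<dots> = flip (block d i) (flip R (lift d (p j)))"
    unfolding p lift_tog[OF d] by auto
  finally show ?thesis using True by (simp only: sweep_full)
next
  case False
  then have "(j * d + s) div d = j" "(j * d + s) mod d = s" using s d by auto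
  then show ?thesis using dir_eq[OF p] by (simp only: lifted_def Let_def)
qed

lemma flip_lift_iff:
  assumes "flip A (lift d P) = flip B (lift d Q)"
  shows "(z \<in> A) \<noteq> (z div d \<in> P) \<longleftrightarrow> (z \<in> B) \<noteq> (z div d \<in> Q)"
proof -
  have "z \<in> flip A (lift d P) \<longleftrightarrow> z \<in> flip B (lift d Q)" by (simp only: assms)
  then show ?thesis by (simp only: mem_flip lift_def mem_Collect_eq)
qed

text \<open>A lifted set is constant on each block, whereas \<open>A\<close> is a nonempty proper
  part of block \<open>i\<close>; only a \<open>B\<close> that meets this block can
  compensate.\<close>

lemma flip_lift_block:
  assumes d: "0 < d" and A: "A \<subseteq> block d i" "card A < d" "A \<noteq> {}" and B: "B \<subseteq> block d k"
    and eq: "flip A (lift d P) = flip B (lift d Q)"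
  shows "i = k \<and> B \<noteq> {}"
proof -
  obtain x where x: "x \<in> A" using A(3) by blast
  have "card (block d i) = d" by (simp add: block_def)
  then have "A \<noteq> block d i" using A(2) by auto
  then obtain y where y: "y \<in> block d i" "y \<notin> A" using A(1) by blast
  have "x \<in> block d i" using x A(1) by blast
  then have xy: "x div d = i" "y div d = i" using y(1) by (simp_all only: mem_block[OF d])
  have "x \<in> B \<or> y \<in> B"
    using flip_lift_iff[OF eq, of x] flip_lift_iff[OF eq, of y] x y(2) unfolding xy by blast
  then obtain z where z: "z \<in> B" "z div d = i" using xy by blast
  then have "z \<in> block d k" using B by blast
  then show ?thesis using z by (auto simp: mem_block[OF d])
qed

text \<open>The first coordinate of an untouched block shows whether its index is in
  \<open>P\<close>, so only the block being swept is in doubt.\<close>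

lemma flip_lift_cases:
  assumes d: "0 < d" and A: "A \<subseteq> block d i" "card A < d" and A': "A' \<subseteq> block d i'" "card A' < d"
    and eq: "flip A (lift d P) = flip A' (lift d P')"
  shows "A = {} \<and> A' = {} \<and> P = P' \<or> A \<noteq> {} \<and> A' \<noteq> {} \<and> i = i' \<and> P' \<in> {P, tog i P}"
proof -
  have off: "l \<in> P \<longleftrightarrow> l \<in> P'" if "l * d \<notin> A" "l * d \<notin> A'" for l
    using flip_lift_iff[OF eq, of "l * d"] that d by simp
  show ?thesis
  proof (cases "A = {} \<and> A' = {}")
    case True
    then have "P = P'" using off by (intro set_eqI) simp
    then show ?thesis using True by simp
  next
    case False
    then have ne: "A \<noteq> {}" "A' \<noteq> {}" "i = i'"
      using flip_lift_block[OF d A _ A'(1) eq] flip_lift_block[OF d A' _ A(1) eq[symmetric]] by blast+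
    have "l \<in> P \<longleftrightarrow> l \<in> P'" if "l \<noteq> i" for l
    proof (rule off)
      have "l * d \<notin> block d i" using that d by (simp add: mem_block)
      then show "l * d \<notin> A" "l * d \<notin> A'" using A(1) A'(1) ne(3) by blast+
    qed
    then have "P' = P \<or> P' = tog i P"
      by (cases "i \<in> P \<longleftrightarrow> i \<in> P'") (fastforce simp: flip_def)+
    then show ?thesis using ne by blast
  qed
qed

lemma inj_lifted:
  assumes d: "0 < d" and inj: "inj_on p {..k}" and p: "\<And>j. j < k \<Longrightarrow> p (Suc j) = tog (dir p j) (p j)"
  shows "inj_on (lifted d R p) {..k * d}"
proof (rule inj_onI)
  fix t t' assume t: "t \<in> {..k * d}" "t' \<in> {..k * d}" and eq: "lifted d R p t = lifted d R p t'"
  let ?A = "\<lambda>t. sweep d (dir p (t div d)) (flip R (lift d (p (t div d)))) (t mod d)"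
  have A: "?A u \<subseteq> block d (dir p (u div d))" "card (?A u) < d" "card (?A u) = u mod d" for u
    using sweep_subset[of "u mod d"] card_sweep[of "u mod d"] mod_less_divisor[OF d, of u]
    by (simp_all add: less_imp_le)
  have form: "flip R (lifted d R p u) = flip (?A u) (lift d (p (u div d)))" for u
    unfolding lifted_def Let_def by auto
  have eqA: "flip (?A t) (lift d (p (t div d))) = flip (?A t') (lift d (p (t' div d)))"
    using form[of t] form[of t'] eq by simp
  have le: "u div d \<le> k" if "u \<le> k * d" for u
    using that d by (metis div_le_mono nonzero_mult_div_cancel_right less_numeral_extra(3))
  have lt: "u div d < k" if "u \<le> k * d" "?A u \<noteq> {}" for u
  proof -
    have "u mod d \<noteq> 0" using that(2) by (auto simp: sweep_0)
    then have "u \<noteq> k * d" by auto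
    then show ?thesis using that(1) d by (simp add: div_less_iff_less_mult)
  qed
  have "t div d = t' div d \<and> t mod d = t' mod d"
    using flip_lift_cases[OF d A(1,2) A(1,2) eqA]
  proof (elim disjE conjE)
    assume "?A t = {}" "?A t' = {}" "p (t div d) = p (t' div d)"
    then show ?thesis
      using inj_onD[OF inj] le t A(3)[of t] A(3)[of t'] by (metis atMost_iff)
  next
    assume ne: "?A t \<noteq> {}" "?A t' \<noteq> {}" and i: "dir p (t div d) = dir p (t' div d)"
      and "p (t' div d) \<in> {p (t div d), tog (dir p (t div d)) (p (t div d))}"
    then consider "p (t' div d) = p (t div d)" | "p (t' div d) = tog (dir p (t div d)) (p (t div d))"
      by blast
    moreover have j: "t div d < k" "t' div d < k" using lt t ne by auto
    ultimately show ?thesis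
    proof cases
      case 1
      then have "t' div d = t div d" using inj_onD[OF inj] j by (meson atMost_iff less_imp_le)
      moreover from this have "?A t = ?A t'" using eqA by (simp only: flip_inject_left)
      ultimately show ?thesis using A(3)[of t] A(3)[of t'] by simp
    next
      \<comment> \<open>The two positions would lie on one edge traversed in opposite directions,
        which makes each index the successor of the other.\<close>
      case 2
      then have "p (t' div d) = p (Suc (t div d))" using p[OF j(1)] by simp
      then have "t' div d = Suc (t div d)" using inj_onD[OF inj, of "t' div d" "Suc (t div d)"] j by simp
      moreover have "p (Suc (t' div d)) = p (t div d)" using p[OF j(2)] 2 i by simp
      then have "Suc (t' div d) = t div d" using inj_onD[OF inj, of "Suc (t' div d)" "t div d"] j by simp
      ultimately show ?thesis by simp
    qed
  qed
  then show "t = t'" by (metis div_mult_mod_eq)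
qed

lemma path_dec_edge:
  assumes bij: "bij_betw (\<lambda>(p, j). {p j, p (Suc j)}) (S \<times> {..<m}) (cube_edges n)" and "p \<in> S" "j < m"
  obtains i where "i < n" "p (Suc j) = tog i (p j)" "p j \<subseteq> {..<n}" "p (Suc j) \<subseteq> {..<n}"
proof -
  have "(\<lambda>(p, j). {p j, p (Suc j)}) (p, j) \<in> cube_edges n"
    using assms by (intro bij_betw_apply[OF bij]) simp
  then obtain X i where X: "{p j, p (Suc j)} = {X, tog i X}" "X \<subseteq> {..<n}" "i < n"
    unfolding cube_edges_def by auto
  moreover have "tog i X \<subseteq> {..<n}" using X by (intro flip_subset) auto
  ultimately show ?thesis using that[of i] by (auto simp: doubleton_eq_iff)
qed

lemma path_dec_mult:
  assumes "odd d" and dec: "path_dec k e"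
  shows "path_dec (k * d) (d * e)"
proof -
  have d: "0 < d" using assms(1) by (cases d) auto
  from dec obtain S where S: "finite S" "\<And>p. p \<in> S \<Longrightarrow> inj_on p {..k}"
    and bij: "bij_betw (\<lambda>(p, j). {p j, p (Suc j)}) (S \<times> {..<k}) (cube_edges e)"
    unfolding path_dec_def by blast
  have dir: "p (Suc j) = tog (dir p j) (p j)" if "p \<in> S" "j < k" for p j
    using path_dec_edge[OF bij that] dir_eq by metis
  define Rs where "Rs = Pow ({..<d * e} - (\<lambda>l. l * d) ` {..<e})"
  have fin: "finite (Rs \<times> S)" using S(1) by (simp add: Rs_def)
  let ?S = "(\<lambda>(R, p). lifted d R p) ` (Rs \<times> S)"
  show ?thesis
  proof (rule path_decI[of ?S])
    show "finite ?S" using fin by (rule finite_imageI)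
    show "inj_on f {..k * d}" if "f \<in> ?S" for f
      using that inj_lifted[OF d S(2) dir] by auto
    show "card ?S * (k * d) \<le> d * e * 2 ^ (d * e - 1)"
    proof (cases "e = 0")
      case True
      then have "S \<times> {..<k} = {}"
        using bij by (auto simp: cube_edges_def bij_betw_def)
      then have "S = {} \<or> k = 0" by auto
      then show ?thesis by auto
    next
      case False
      have "inj_on (\<lambda>l. l * d) {..<e}" using d by (intro inj_onI) simp
      then have cardR: "card Rs = 2 ^ (d * e - e)"
        unfolding Rs_def using d
        by (subst card_Pow, simp, subst card_Diff_subset) (auto simp: card_image mult.commute)
      have "card S * k = e * 2 ^ (e - 1)"
        using bij_betw_same_card[OF bij] by (simp add: card_cartesian_product card_cube_edges)
      moreover have "card ?S \<le> card Rs * card S"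
        using card_image_le[OF fin] by (simp add: card_cartesian_product)
      then have "card ?S * (k * d) \<le> card Rs * card S * (k * d)" by (rule mult_right_mono) simp
      ultimately have "card ?S * (k * d) \<le> 2 ^ (d * e - e) * (e * 2 ^ (e - 1)) * d"
        unfolding cardR by (metis (no_types, lifting) mult.assoc)
      also have "\<dots> = d * e * 2 ^ (d * e - e + (e - 1))" by (simp add: power_add)
      also have "d * e - e + (e - 1) = d * e - 1"
      proof -
        have "1 * e \<le> d * e" using d by (intro mult_le_mono1) simp
        then show ?thesis using False by simp
      qed
      finally show ?thesis .
    qed
    fix X x assume X: "X \<subseteq> {..<d * e}" and x: "x < d * e"
    define i s where "i = x div d" and "s = x mod d"
    have xis: "x = i * d + s" and s: "s < d" and i: "i < e"
      using x d by (simp_all add: i_def s_def div_less_iff_less_mult mult.commute)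
    let ?I = "{i * d..<i * d + s}"
    \<comment> \<open>\<open>W\<close> is the end reached by sweeping \<open>s\<close> coordinates
      upwards from a vertex with an even number of ones in the block; the two ends give opposite
      parities, so one of them qualifies.\<close>
    obtain W where W: "{X, tog x X} = {W, tog x W}" "W \<subseteq> {..<d * e}"
      and even_W: "even (card (flip ?I W \<inter> block d i))"
    proof (cases "even (card (flip ?I X \<inter> block d i))")
      case True then show ?thesis using that X by blast
    next
      case False
      have "x \<in> block d i" using xis s by (simp add: block_def)
      then have "flip ?I (tog x X) \<inter> block d i = tog x (flip ?I X \<inter> block d i)" by auto
      moreover have "finite (flip ?I X \<inter> block d i)" by (simp add: block_def)
      ultimately have "even (card (flip ?I (tog x X) \<inter> block d i))"
        using False by (simp add: even_card_flip)
      moreover have "tog x X \<subseteq> {..<d * e}" using X x by (intro flip_subset) auto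
      ultimately show ?thesis using that[OF edge_sym] by blast
    qed
    define U where "U = flip ?I W"
    have "i * d + s < d * e" using x xis by simp
    then have "?I \<subseteq> {..<d * e}" by auto
    then have U: "U \<subseteq> {..<d * e}" unfolding U_def using W(2) by (rule flip_subset)
    have evenU: "even (card (U \<inter> block d i))" using even_W by (simp add: U_def)
    \<comment> \<open>The first coordinates of the blocks spell the vertex of the
      \<open>e\<close>-cube, so \<open>U\<close> has the form \<open>flip R (lift d P)\<close> with
      \<open>R\<close> in \<open>Rs\<close>.\<close>
    define P where "P = {l. l * d \<in> U}"
    have P: "P \<subseteq> {..<e}"
    proof
      fix l assume "l \<in> P"
      then have "l * d < d * e" using U by (auto simp: P_def)
      then show "l \<in> {..<e}" using d by (simp add: mult.commute)
    qed
    define R where "R = flip U (lift d P)"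
    have RU: "flip R (lift d P) = U" by (auto simp: R_def)
    have "lift d P \<subseteq> {..<d * e}"
    proof
      fix y assume "y \<in> lift d P"
      then have "y div d < e" using P by (auto simp: lift_def)
      then show "y \<in> {..<d * e}" using d by (simp add: div_less_iff_less_mult mult.commute)
    qed
    then have "R \<subseteq> {..<d * e}" unfolding R_def using U by (intro flip_subset)
    moreover have "l * d \<notin> R" for l using d by (simp add: R_def lift_def P_def)
    ultimately have R: "R \<in> Rs" unfolding Rs_def by auto
    have "{P, tog i P} \<in> cube_edges e" unfolding cube_edges_def using P i by blast
    then have "{P, tog i P} \<in> (\<lambda>(p, j). {p j, p (Suc j)}) ` (S \<times> {..<k})"
      using bij_betw_imp_surj_on[OF bij] by simp
    then obtain p j where p: "p \<in> S" "j < k" "{P, tog i P} = {p j, p (Suc j)}" by auto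
    have in_S: "lifted d R p \<in> ?S" using R p(1) by (intro image_eqI[of _ _ "(R, p)"]) auto
    have pos: "j * d + u < k * d" if "u < d" for u
    proof -
      have "j * d + u < Suc j * d" using that by simp
      also have "\<dots> \<le> k * d" using p(2) by (intro mult_le_mono1) simp
      finally show ?thesis .
    qed
    have WU: "W = flip ?I U" by (simp add: U_def)
    have TU: "tog x W = flip {i * d..<i * d + Suc s} U"
      unfolding WU using xis by (auto simp: less_Suc_eq)
    have "\<exists>u<d. {lifted d R p (j * d + u), lifted d R p (j * d + Suc u)} = {W, tog x W}"
    proof (cases "p j = P")
      case True
      then have "p (Suc j) = tog i (p j)" using p(3) by (metis doubleton_eq_iff)
      note lifted = lifted_eq[where p = p and j = j, OF d this]
      have L: "lifted d R p (j * d + u) = flip (sweep d i U u) U" if "u \<le> d" for u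
        using lifted[OF that, of R] unfolding True RU .
      have "sweep d i U u = {i * d..<i * d + u}" for u using evenU by (simp add: sweep_def)
      then have "lifted d R p (j * d + s) = W" "lifted d R p (j * d + Suc s) = tog x W"
        using L[of s] L[of "Suc s"] s unfolding TU by (simp_all add: WU[symmetric])
      then show ?thesis using s by blast
    next
      \<comment> \<open>Here \<open>p\<close> runs from \<open>tog i P\<close> to \<open>P\<close>.
        As \<open>d\<close> is odd, this start has odd parity in the block, the sweep descends, and
        after \<open>u\<close> flips it is where the ascending one is after \<open>d - u\<close>.
        Hence the time \<open>d - Suc s\<close>.\<close>
      case False
      then have pj: "p j = tog i P" "p (Suc j) = P" using p(3) by (metis doubleton_eq_iff)+
      then have "p (Suc j) = tog i (p j)" by simp
      note lifted = lifted_eq[where p = p and j = j, OF d this]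
      have X: "flip R (lift d (p j)) = flip (block d i) U"
        unfolding pj lift_tog[OF d] RU[symmetric] by auto
      have L: "lifted d R p (j * d + u) = flip (sweep d i (flip (block d i) U) u) (flip (block d i) U)" if "u \<le> d" for u
        using lifted[OF that, of R] unfolding X .
      have "flip (block d i) U \<inter> block d i = flip (block d i) (U \<inter> block d i)" by auto
      then have "odd (card (flip (block d i) U \<inter> block d i))"
        using evenU assms(1) by (simp add: even_card_flip block_def)
      then have sw: "sweep d i (flip (block d i) U) u = {i * d + d - u..<i * d + d}" for u
        by (simp add: sweep_def)
      have L': "lifted d R p (j * d + u) = flip {i * d..<i * d + (d - u)} U" if "u \<le> d" for u
      proof -
        have "flip {i * d + d - u..<i * d + d} (block d i) = {i * d..<i * d + (d - u)}"
          using that by (auto simp: block_def)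
        then show ?thesis unfolding L[OF that] sw by (metis flip_assoc)
      qed
      have u: "d - (d - Suc s) = Suc s" "d - Suc (d - Suc s) = s" "Suc (d - Suc s) \<le> d" "d - Suc s < d"
        using s by auto
      have "lifted d R p (j * d + Suc (d - Suc s)) = W" "lifted d R p (j * d + (d - Suc s)) = tog x W"
        using L'[of "Suc (d - Suc s)"] L'[of "d - Suc s"] u unfolding TU by (simp_all add: WU[symmetric])
      then show ?thesis using u(4) by (intro exI[of _ "d - Suc s"]) (auto simp: insert_commute)
    qed
    then obtain u where "u < d" "{lifted d R p (j * d + u), lifted d R p (Suc (j * d + u))} = {X, tog x X}"
      unfolding W(1) by auto
    then show "\<exists>f\<in>?S. \<exists>u<k * d. {f u, f (Suc u)} = {X, tog x X}"
      using in_S pos by blast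
  qed
qed

section \<open>Translation to graphs\<close>

definition bits :: "nat \<Rightarrow> nat set \<Rightarrow> bool list" where
  "bits q X = map (\<lambda>i. i \<in> X) [0..<q]"

lemma length_bits [simp]: "length (bits q X) = q"
  by (simp add: bits_def)

lemma nth_bits [simp]: "i < q \<Longrightarrow> bits q X ! i \<longleftrightarrow> i \<in> X"
  by (simp add: bits_def)

lemma bits_inject: "X \<subseteq> {..<q} \<Longrightarrow> Y \<subseteq> {..<q} \<Longrightarrow> bits q X = bits q Y \<longleftrightarrow> X = Y"
  by (auto simp: list_eq_iff_nth_eq)

lemma bits_surj: "length x = q \<Longrightarrow> bits q {i. i < q \<and> x ! i} = x"
  by (auto simp: list_eq_iff_nth_eq)

lemma edges_hypercube: "edges (hypercube q) = (\<lambda>E. bits q ` E) ` cube_edges q"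
proof
  show "edges (hypercube q) \<subseteq> (\<lambda>E. bits q ` E) ` cube_edges q"
  proof
    fix E assume "E \<in> edges (hypercube q)"
    then obtain x y where E: "E = {x, y}" "length x = q" "length y = q"
      and "card {i. i < q \<and> x ! i \<noteq> y ! i} = 1"
      by (auto simp: edges_def hypercube_def)
    then obtain j where j: "{i. i < q \<and> x ! i \<noteq> y ! i} = {j}" by (metis card_1_singletonE)
    let ?X = "{i. i < q \<and> x ! i}"
    have "bits q (tog j ?X) = y"
      using j E by (auto simp: list_eq_iff_nth_eq set_eq_iff)
    then have "E = bits q ` {?X, tog j ?X}"
      unfolding E(1) by (simp only: image_insert image_empty bits_surj[OF E(2)])
    moreover have "j < q" using j by auto
    then have "{?X, tog j ?X} \<in> cube_edges q" unfolding cube_edges_def by blast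
    ultimately show "E \<in> (\<lambda>E. bits q ` E) ` cube_edges q" by blast
  qed
  show "(\<lambda>E. bits q ` E) ` cube_edges q \<subseteq> edges (hypercube q)"
  proof
    fix E assume "E \<in> (\<lambda>E. bits q ` E) ` cube_edges q"
    then obtain X j where X: "E = {bits q X, bits q (tog j X)}" "j < q"
      by (auto simp: cube_edges_def)
    have "{i. i < q \<and> bits q X ! i \<noteq> bits q (tog j X) ! i} = {j}" using X by auto
    then have "card {i. i < q \<and> bits q X ! i \<noteq> bits q (tog j X) ! i} = 1" by simp
    then show "E \<in> edges (hypercube q)"
      unfolding edges_def hypercube_def snd_conv X(1) mem_Collect_eq using length_bits by blast
  qed
qed

definition path_image :: "(nat \<Rightarrow> 'a) \<Rightarrow> nat \<Rightarrow> 'a graph" where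
  "path_image g m = (g ` {..m}, (\<lambda>j. {g j, g (Suc j)}) ` {..<m})"

lemma verts_path_image: "verts (path_image g m) = g ` {..m}"
  and edges_path_image: "edges (path_image g m) = (\<lambda>j. {g j, g (Suc j)}) ` {..<m}"
  by (simp_all add: path_image_def verts_def edges_def)

lemma path_graph_eq: "path_graph m = path_image (\<lambda>j. j) m"
proof -
  have "{{j - 1, j} | j. 1 \<le> j \<and> j \<le> m} = (\<lambda>j. {j, Suc j}) ` {..<m}"
  proof (intro equalityI subsetI)
    fix E assume "E \<in> {{j - 1, j} | j. 1 \<le> j \<and> j \<le> m}"
    then obtain j where "E = {j - 1, j}" "1 \<le> j" "j \<le> m" by blast
    then show "E \<in> (\<lambda>j. {j, Suc j}) ` {..<m}" by (intro image_eqI[of _ _ "j - 1"]) simp_all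
  next
    fix E assume "E \<in> (\<lambda>j. {j, Suc j}) ` {..<m}"
    then obtain j where "E = {j, Suc j}" "j < m" by blast
    then show "E \<in> {{j - 1, j} | j. 1 \<le> j \<and> j \<le> m}"
      by (intro CollectI exI[of _ "Suc j"]) simp
  qed
  then show ?thesis by (simp add: path_graph_def path_image_def atLeast0AtMost)
qed

lemma wf_path_image:
  assumes "inj_on g {..m}"
  shows "wf_graph (path_image g m)"
  unfolding wf_graph_def
proof
  fix E assume "E \<in> edges (path_image g m)"
  then obtain j where j: "j < m" "E = {g j, g (Suc j)}" unfolding edges_path_image by blast
  then have "g j \<noteq> g (Suc j)" using inj_on_eq_iff[OF assms, of j "Suc j"] by simp
  moreover have "g j \<in> verts (path_image g m)" "g (Suc j) \<in> verts (path_image g m)"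
    using j(1) by (simp_all add: verts_path_image)
  ultimately show "\<exists>u v. u \<noteq> v \<and> u \<in> verts (path_image g m) \<and> v \<in> verts (path_image g m) \<and> E = {u, v}"
    using j(2) by blast
qed

lemma graph_iso_path_image:
  assumes inj: "inj_on g {..m}"
  shows "graph_iso (path_image g m) (path_graph m)"
proof -
  let ?f = "the_inv_into {..m} g"
  have "bij_betw ?f (verts (path_image g m)) (verts (path_graph m))"
    unfolding path_graph_eq verts_path_image
    using bij_betw_the_inv_into[OF inj_on_imp_bij_betw[OF inj]] by simp
  moreover have "{u, v} \<in> edges (path_image g m) \<longleftrightarrow> {?f u, ?f v} \<in> edges (path_graph m)"
    if uv: "u \<in> verts (path_image g m)" "v \<in> verts (path_image g m)" for u v
  proof -
    obtain a b where ab: "a \<le> m" "b \<le> m" "u = g a" "v = g b"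
      using uv unfolding verts_path_image by auto
    then have f: "?f (g a) = a" "?f (g b) = b" using the_inv_into_f_f[OF inj] by simp_all
    have "{g a, g b} = {g j, g (Suc j)} \<longleftrightarrow> {a, b} = {j, Suc j}" if "j < m" for j
      using inj_on_eq_iff[OF inj] ab(1,2) that by (simp add: doubleton_eq_iff)
    then show ?thesis
      unfolding path_graph_eq edges_path_image ab(3,4) f by (simp add: image_iff Bex_def cong: conj_cong)
  qed
  ultimately show ?thesis unfolding graph_iso_def by blast
qed

lemma image_image_Times: "h ` (\<lambda>(p, j). f p j) ` (S \<times> A) = (\<Union>p\<in>S. (\<lambda>j. h (f p j)) ` A)"
  by auto

lemma path_dec_imp_graph_divides:
  assumes dec: "path_dec m q" and m: "0 < m"
  shows "graph_divides (path_graph m) (hypercube q)"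
proof -
  from dec obtain S where inj: "\<And>p. p \<in> S \<Longrightarrow> inj_on p {..m}"
    and bij: "bij_betw (\<lambda>(p, j). {p j, p (Suc j)}) (S \<times> {..<m}) (cube_edges q)"
    unfolding path_dec_def by blast
  \<comment> \<open>Since \<open>m\<close> is positive, every vertex of a path is an end of one of
    its edges.\<close>
  have sub: "p j \<subseteq> {..<q}" if p: "p \<in> S" and j: "j \<le> m" for p j
  proof (cases j)
    case 0
    from path_dec_edge[OF bij p m] show ?thesis unfolding 0 by blast
  next
    case (Suc i)
    then have "i < m" using j by simp
    from path_dec_edge[OF bij p this] show ?thesis unfolding Suc by blast
  qed
  have inj_bits: "inj_on (bits q) (Pow {..<q})"
  proof (rule inj_onI)
    fix X Y assume "X \<in> Pow {..<q}" "Y \<in> Pow {..<q}" "bits q X = bits q Y"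
    then show "X = Y" using bits_inject[of X q Y] by simp
  qed
  let ?K = "\<lambda>p. path_image (bits q \<circ> p) m"
  have inj_K: "inj_on (bits q \<circ> p) {..m}" if "p \<in> S" for p
  proof (rule comp_inj_on)
    show "inj_on p {..m}" using that by (rule inj)
    have "p ` {..m} \<subseteq> Pow {..<q}" using sub[OF that] by (intro image_subsetI PowI) simp
    with inj_bits show "inj_on (bits q) (p ` {..m})" by (rule inj_on_subset)
  qed
  have edges_K: "edges (?K p) = (\<lambda>j. bits q ` {p j, p (Suc j)}) ` {..<m}" for p
    unfolding edges_path_image by simp
  have "edges (hypercube q) = (\<Union>p\<in>S. edges (?K p))"
    unfolding edges_hypercube edges_K bij_betw_imp_surj_on[OF bij, symmetric]
    by (rule image_image_Times[where h = "(`) (bits q)" and f = "\<lambda>p j. {p j, p (Suc j)}"])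
  then have union: "(\<Union>p\<in>S. edges (?K p)) = edges (hypercube q)" by (rule sym)
  have disj: "p = p'" if p: "p \<in> S" "p' \<in> S" and E: "E \<in> edges (?K p)" "E \<in> edges (?K p')" for p p' E
  proof -
    obtain j j' where j: "j < m" "j' < m"
      and eq: "bits q ` {p j, p (Suc j)} = bits q ` {p' j', p' (Suc j')}"
      using E unfolding edges_K by blast
    have *: "{p j, p (Suc j)} \<subseteq> Pow {..<q}" "{p' j', p' (Suc j')} \<subseteq> Pow {..<q}"
      using sub[OF p(1)] sub[OF p(2)] j by simp_all
    have "{p j, p (Suc j)} = {p' j', p' (Suc j')}"
      using eq unfolding inj_on_image_eq_iff[OF inj_bits *] .
    then have "(p, j) = (p', j')"
      using inj_onD[OF bij_betw_imp_inj_on[OF bij], of "(p, j)" "(p', j')"] p j by simp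
    then show ?thesis by simp
  qed
  have subK: "subgraph (?K p) (hypercube q)" if p: "p \<in> S" for p
  proof -
    have "verts (?K p) \<subseteq> verts (hypercube q)"
      unfolding verts_path_image by (auto simp: verts_def hypercube_def)
    moreover have "edges (?K p) \<subseteq> edges (hypercube q)" unfolding union[symmetric] using p by blast
    ultimately show ?thesis unfolding subgraph_def using wf_path_image[OF inj_K[OF p]] by blast
  qed
  show ?thesis
    unfolding graph_divides_def
  proof (intro exI[of _ "?K ` S"] conjI ballI impI)
    fix G assume "G \<in> ?K ` S"
    then obtain p where p: "p \<in> S" "G = ?K p" by blast
    show "subgraph G (hypercube q)" unfolding p(2) using p(1) by (rule subK)
    show "graph_iso G (path_graph m)" unfolding p(2) using inj_K[OF p(1)] by (rule graph_iso_path_image)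
  next
    show "(\<Union>G\<in>?K ` S. edges G) = edges (hypercube q)" using union by simp
  next
    fix G G' assume G: "G \<in> ?K ` S" "G' \<in> ?K ` S" "G \<noteq> G'"
    show "edges G \<inter> edges G' = {}"
    proof (rule ccontr)
      assume "edges G \<inter> edges G' \<noteq> {}"
      then obtain E where "E \<in> edges G" "E \<in> edges G'" by blast
      moreover obtain p p' where "p \<in> S" "p' \<in> S" "G = ?K p" "G' = ?K p'" using G(1,2) by blast
      ultimately show False using disj[of p p' E] G(3) by simp
    qed
  qed
qed

section \<open>Choice of r and assembly of the factors of m\<close>

lemma double_le_power: "0 < a \<Longrightarrow> 2 * a \<le> 2 ^ (a :: nat)"
proof (induction a)
  case (Suc a)
  then show ?case by (cases "a = 0") auto
qed simp

lemma path_dec_power_2: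
  assumes "odd e" "2 ^ a \<le> e"
  shows "path_dec (2 ^ a) e"
proof (cases "a = 0")
  case True
  then show ?thesis using path_dec_1 by simp
next
  case False
  \<comment> \<open>The least \<open>r\<close> with \<open>2 ^ a < 4 ^ r\<close>. It still satisfies
    \<open>4 * r - 4 \<le> 2 * a\<close>, and \<open>2 * a \<le> 2 ^ a\<close> gives the length that
    the walks require.\<close>
  define r where "r = Suc (a div 2)"
  have a: "2 * a \<le> 2 ^ a" using False double_le_power by simp
  have ar: "a < 2 * r" "2 * r \<le> a + 2" by (auto simp: r_def)
  have pow: "(4 :: nat) ^ r = 2 ^ (2 * r)" by (simp add: power_mult)
  show ?thesis
  proof (rule path_dec_even)
    show "0 < r" by (simp add: r_def)
    show "4 * r - 4 \<le> 2 ^ a" using a ar by linarith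
    show "2 * r \<le> 2 ^ a"
    proof (cases "a = 1")
      case True then show ?thesis by (simp add: r_def)
    next
      case False then show ?thesis using a ar \<open>a \<noteq> 0\<close> by linarith
    qed
    show "even ((2 :: nat) ^ a)" using False by simp
    then have "2 ^ a \<noteq> e" using assms(1) by auto
    then show "2 ^ a < e" using assms(2) by simp
    show "2 ^ a dvd (4 :: nat) ^ r" unfolding pow using ar by (intro le_imp_power_dvd) simp
    show "(2 :: nat) ^ a < 4 ^ r" unfolding pow using ar by simp
    show "odd e" by (rule assms)
  qed
qed

theorem theorem5:
  fixes q m :: nat
  assumes "odd q" and "0 < q" and "q < 2 ^ 32"
    and "0 < m" and "m \<le> q" and "m dvd q * 2 ^ (q - 1)"
  shows "graph_divides (path_graph m) (hypercube q)"
proof -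
  obtain a d where m: "m = 2 ^ a * d" and "odd d"
    by (rule multiplicity_decompose'[of m 2]) (use assms(4) in auto)
  have "d dvd q * 2 ^ (q - 1)" using assms(6) m by (metis dvd_mult_right)
  then have "d dvd q" using \<open>odd d\<close> by (simp add: coprime_dvd_mult_left_iff)
  then obtain e where q: "q = d * e" by (rule dvdE)
  have "2 ^ a \<le> e" using assms(5) \<open>odd d\<close> unfolding m q by (simp add: mult.commute odd_pos)
  moreover have "odd e" using assms(1) q by simp
  ultimately have "path_dec (2 ^ a) e" by (intro path_dec_power_2)
  then have "path_dec m q" unfolding m q using \<open>odd d\<close> by (intro path_dec_mult)
  then show ?thesis using assms(4) by (rule path_dec_imp_graph_divides)
qed

end
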